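(* For $n\geq 3$, let $r=r(n)\geq 3$ be an integer and let $\boldsymbol{k}=\boldsymbol{k}(n)=(k_1,\ldots,k_n)$ be a vector of nonnegative integers, where each $k_j=k_j(n)$ may depend on $n$. Let $k_{\max}=k_{\max}(n)=\max_{j=1}^n k_j$, $M=M(n)=\sum_{j=1}^n k_j$ and $M_2=M_2(n)=\sum_{j=1}^n k_j(k_j-1)$ for all $n\geq 3$. Suppose that the set \[ \mathcal{I}=\{n\geq 3 \mid r(n)\text{ divides } M(n)\}\] is infinite, and that $M\to\infty$ and $r^4k_{\max}^3=o(M)$ as $n$ tends to infinity along elements of $\mathcal{I}$. Let $\mathcal{H}_r(\boldsymbol{k})$ be the set of all simple $r$-uniform hypergraphs on the vertex set $[n]=\{1,\ldots,n\}$ with degree sequence $\boldsymbol{k}$. Then, as $n\to\infty$ along $\mathcal{I}$, \[ |\mathcal{H}_r(\boldsymbol{k})| = \frac{M!}{(M/r)!\,(r!)^{M/r}\,\prod_{i=1}^n k_i!}\,\exp\left(-\frac{(r-1)M_2}{2M}+O\left(\frac{r^4k_{\max}^3}{M}\right)\right).\]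
   Context: A hypergraph is a pair $(V,E)$ where $V$ is a finite set and $E$ is a multiset of multisubsets of $V$ (the edges). A vertex with multiplicity at least 2 in an edge is a loop in that edge. A hypergraph is simple if it has no loops and no repeated edges (so $E$ is a set of subsets of $V$; distinct edges may share more than one vertex). A hypergraph is $r$-uniform if every edge contains exactly $r$ vertices (counting multiplicities). Degree sequence $\boldsymbol{k}$ means that vertex $j$ has degree $k_j$ (the number of edges containing $j$, for a simple hypergraph) for $j=1,\ldots,n$. *)

theory Defs
  imports Complex_Main "HOL-Library.Multiset" "HOL-Library.Landau_Symbols"
begin

type_synonym 'a hypergraph = "'a set \<times> 'a multiset multiset"

definition hypergraph :: "'a hypergraph \<Rightarrow> bool" where
  "hypergraph H \<longleftrightarrow> finite (fst H) \<and> (\<forall>e \<in># snd H. set_mset e \<subseteq> fst H)"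

definition loop_in :: "'a \<Rightarrow> 'a multiset \<Rightarrow> bool" where
  "loop_in v e \<longleftrightarrow> count e v \<ge> 2"

definition simple_hypergraph :: "'a hypergraph \<Rightarrow> bool" where
  "simple_hypergraph H \<longleftrightarrow> hypergraph H
     \<and> (\<forall>e \<in># snd H. \<forall>v. \<not> loop_in v e)
     \<and> (\<forall>e \<in># snd H. count (snd H) e = 1)"

definition uniform_hypergraph :: "nat \<Rightarrow> 'a hypergraph \<Rightarrow> bool" where
  "uniform_hypergraph r H \<longleftrightarrow> hypergraph H \<and> (\<forall>e \<in># snd H. size e = r)"

(* Loops are not counted with multiplicity: the notion is used for simple hypergraphs only. *)
definition vertex_degree :: "'a hypergraph \<Rightarrow> 'a \<Rightarrow> nat" where
  "vertex_degree H v = size (filter_mset (\<lambda>e. v \<in># e) (snd H))"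

definition simple_uniform_hypergraphs ::
    "nat \<Rightarrow> nat \<Rightarrow> (nat \<Rightarrow> nat) \<Rightarrow> nat hypergraph set" where
  "simple_uniform_hypergraphs n r k =
     {H. fst H = {1..n} \<and> simple_hypergraph H \<and> uniform_hypergraph r H
         \<and> (\<forall>j \<in> {1..n}. vertex_degree H j = k j)}"

lemma finite_simple_uniform_hypergraphs: "finite (simple_uniform_hypergraphs n r k)"
proof -
  let ?A = "{e. set_mset e \<subseteq> {1..n} \<and> size e = r}"
  have fA: "finite ?A" 
  proof -
    have "?A \<subseteq> mset ` {xs. set xs \<subseteq> {1..n} \<and> length xs = r}"
    proof
      fix e assume "e \<in> ?A"
      moreover obtain xs where "mset xs = e" using ex_mset by blast
      ultimately show "e \<in> mset ` {xs. set xs \<subseteq> {1..n} \<and> length xs = r}" by force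
    qed
    thus ?thesis using finite_lists_length_eq[of "{1..n}" r] finite_surj by blast
  qed
  have "simple_uniform_hypergraphs n r k \<subseteq> {{1..n}} \<times> mset_set ` Pow ?A"
  proof
    fix H assume H: "H \<in> simple_uniform_hypergraphs n r k"
    have "snd H = mset_set (set_mset (snd H))"
      using H by (intro multiset_eqI) (auto simp: simple_uniform_hypergraphs_def simple_hypergraph_def count_mset_set' not_in_iff)
    moreover have "set_mset (snd H) \<subseteq> ?A" using H
      by (auto simp: simple_uniform_hypergraphs_def uniform_hypergraph_def hypergraph_def)
    ultimately have "snd H \<in> mset_set ` Pow ?A" by blast
    thus "H \<in> {{1..n}} \<times> mset_set ` Pow ?A" using H by (cases H) (auto simp: simple_uniform_hypergraphs_def)
  qed
  thus ?thesis by (rule finite_subset) (use fA in auto)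
qed

(* Restriction of n \<longrightarrow> \<infinity> to the elements of I;
   it is the trivial filter when I is finite. *)
definition along :: "nat set \<Rightarrow> nat filter" where
  "along I = inf sequentially (principal I)"

end

theory Submission
  imports Defs "HOL-Combinatorics.Multiset_Permutations"
begin

text \<open>
  Write each edge as a row of \<open>r\<close> vertices and list the \<open>N = M / r\<close> rows one after the other.
  This gives a word of length \<open>M\<close> in which vertex \<open>j\<close> occurs \<open>k j\<close> times. There are
  \<open>M! / (\<Prod>j. (k j)!)\<close> such words, and every simple hypergraph arises from exactly
  \<open>N! * (r!) ^ N\<close> of them. So the theorem says that a uniformly random word is simple, that is,
  has no loop in a block and no two blocks with the same vertices, with probability
  \<open>exp (- (r - 1) * M2 / (2 * M) + O(r ^ 4 * kmax ^ 3 / M))\<close>.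

  Loops. There are \<open>M * (r - 1) / 2\<close> pairs of positions inside a block. They are forbidden to
  carry equal vertices one pair at a time, so that the probability of having no loop becomes a
  product of conditional probabilities. The key point is that each factor can be computed to
  high precision by a switching: given that the pairs in \<open>Q\<close> carry distinct vertices, exchange
  the entries at a further pair \<open>{a, b}\<close> with those at an arbitrary pair \<open>(s, t)\<close> of positions.
  Unless \<open>s\<close> or \<open>t\<close> is one of \<open>O(r * kmax)\<close> clashing positions, the exchange violates no
  condition in \<open>Q\<close>, provided that \<open>s\<close> and \<open>t\<close> do not form a pair in \<open>Q\<close> themselves. It is its
  own inverse, and it turns a loop at \<open>{a, b}\<close> into equal entries at \<open>(s, t)\<close>. Every word has
  exactly \<open>M2\<close> ordered pairs of distinct positions with equal entries, out of \<open>M\<^sup>2\<close>. Hence the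
  conditional probability of a loop at \<open>{a, b}\<close> is \<open>M2 / M\<^sup>2 + O(r * kmax\<^sup>2 / M\<^sup>2)\<close>, whatever
  \<open>Q\<close> is (lemmas \<open>coincidence_upper\<close> and \<open>coincidence_lower\<close>). The product of the factors is
  \<open>exp (- (r - 1) * M2 / (2 * M) + O(r\<^sup>2 * kmax\<^sup>2 / M))\<close> (lemma \<open>card_loop_free_estimate\<close>).

  Repeated edges. If two blocks agree then three given positions of one of them repeat vertices
  of the other. A similar switching of a single entry shows that each such coincidence costs a
  factor \<open>O(kmax / M)\<close>, even among loop-free words. Summing over pairs of blocks and positions
  bounds the proportion of loop-free words with a repeated block by \<open>O(r * kmax ^ 3 / M)\<close>
  (lemma \<open>card_not_simple\<close>).
\<close>

section \<open>Swapping two entries of a list\<close>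

definition swap_entries :: "'a list \<Rightarrow> nat \<Rightarrow> nat \<Rightarrow> 'a list" where
  "swap_entries w i j = w[i := w ! j, j := w ! i]"

lemma length_swap_entries [simp]: "length (swap_entries w i j) = length w"
  by (simp add: swap_entries_def)

lemma nth_swap_entries:
  assumes "i < length w" "j < length w"
  shows "swap_entries w i j ! u = (if u = i then w ! j else if u = j then w ! i else w ! u)"
  using assms by (auto simp: swap_entries_def nth_list_update)

lemma swap_entries_involutive:
  assumes "i < length w" "j < length w"
  shows "swap_entries (swap_entries w i j) i j = w"
  by (rule nth_equalityI) (use assms in \<open>auto simp: nth_swap_entries\<close>)

lemma mset_swap_entries:
  assumes "i < length w" "j < length w"
  shows "mset (swap_entries w i j) = mset w"
  using assms by (simp add: swap_entries_def mset_swap)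

section \<open>Words divided into blocks\<close>

lemma div_eq_block: "0 < r \<Longrightarrow> {u. u div r = c} = {c * r..<c * r + (r::nat)}"
proof (intro set_eqI iffI)
  fix u assume r: "0 < r" and u: "u \<in> {u. u div r = c}"
  have "u = c * r + u mod r" using u div_mult_mod_eq[of u r] by simp
  moreover have "u mod r < r" using r by simp
  ultimately show "u \<in> {c * r..<c * r + r}" unfolding atLeastLessThan_iff by linarith
next
  fix u assume r: "0 < r" and u: "u \<in> {c * r..<c * r + r}"
  then show "u \<in> {u. u div r = c}" by (auto intro!: div_nat_eqI simp: mult.commute)
qed

lemma card_block: "0 < r \<Longrightarrow> card {u. u div r = (c::nat)} = r"
  by (simp add: div_eq_block)

lemma finite_block: "0 < r \<Longrightarrow> finite {u. u div r = (c::nat)}"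
  by (simp add: div_eq_block)

text \<open>
  An \<open>r\<close>-uniform hypergraph with \<open>N\<close> edges is encoded by listing its edges one after the other,
  each as a block of \<open>r\<close> consecutive positions. The multiset \<open>A\<close> prescribes how often every
  vertex occurs in the list, that is, the degrees; \<open>K\<close> is a bound on them.
\<close>

locale block_words =
  fixes r N K :: nat and A :: "'a multiset"
  assumes r_pos: "0 < r" and K_pos: "0 < K"
    and size_A: "size A = N * r"
    and count_le: "count A v \<le> K"
begin

abbreviation M :: nat where "M \<equiv> size A"

abbreviation words :: "'a list set" where "words \<equiv> permutations_of_multiset A"

text \<open>
  This is the number of ordered pairs of distinct positions that carry the same vertex; it is
  the same for all words.
\<close>

definition M2 :: nat where
  "M2 = (\<Sum>v\<in>set_mset A. count A v * (count A v - 1))"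

definition block_pairs :: "nat set set" where
  "block_pairs = {p. p \<subseteq> {..<M} \<and> card p = 2 \<and> (\<forall>x\<in>p. \<forall>y\<in>p. x div r = y div r)}"

text \<open>
  The set \<open>Q\<close> may contain only some of the block pairs. Admitting the intermediate sets lets
  the loops be forbidden one pair at a time.
\<close>

definition avoiding :: "nat set set \<Rightarrow> 'a list set" where
  "avoiding Q = {w \<in> words. \<forall>x y. {x, y} \<in> Q \<longrightarrow> w ! x \<noteq> w ! y}"

lemma length_word: "w \<in> words \<Longrightarrow> length w = M"
  by (metis permutations_of_multisetD size_mset)

lemma swap_word: "w \<in> words \<Longrightarrow> i < M \<Longrightarrow> j < M \<Longrightarrow> swap_entries w i j \<in> words"
  by (simp add: length_word mset_swap_entries permutations_of_multiset_def)

lemma finite_avoiding [simp]: "finite (avoiding Q)"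
  by (simp add: avoiding_def)

lemma avoiding_word: "w \<in> avoiding Q \<Longrightarrow> w \<in> words"
  by (simp add: avoiding_def)

lemma card_fibre:
  assumes "w \<in> words"
  shows "card {s. s < M \<and> w ! s = v} = count A v"
proof -
  have "count A v = length (filter (\<lambda>y. v = y) w)"
    using assms by (metis count_list_eq_length_filter count_mset permutations_of_multisetD)
  also have "\<dots> = card {s. s < M \<and> w ! s = v}"
    using assms by (auto simp: length_filter_conv_card length_word intro!: arg_cong[of _ _ card])
  finally show ?thesis by simp
qed

lemma card_fibre_le: "w \<in> words \<Longrightarrow> card {s. s < M \<and> w ! s = v} \<le> K"
  by (simp add: card_fibre count_le)

lemma card_coincidences:
  assumes "w \<in> words"
  shows "card {(s, t). s < M \<and> t < M \<and> s \<noteq> t \<and> w ! s = w ! t} = M2"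
proof -
  have eq: "{(s, t). s < M \<and> t < M \<and> s \<noteq> t \<and> w ! s = w ! t}
        = (SIGMA s:{..<M}. {t. t < M \<and> w ! t = w ! s} - {s})" by auto
  have c: "card ({t. t < M \<and> w ! t = w ! s} - {s}) = count A (w ! s) - 1" if "s < M" for s
    using that card_fibre[OF assms, of "w ! s"] by (simp add: card_Diff_singleton)
  have "card {(s, t). s < M \<and> t < M \<and> s \<noteq> t \<and> w ! s = w ! t} = (\<Sum>s<M. count A (w ! s) - 1)"
    unfolding eq using c by (subst card_SigmaI) auto
  also have "\<dots> = sum_list (map (\<lambda>v. count A v - 1) w)"
    using assms by (simp add: sum_list_sum_nth length_word lessThan_atLeast0)
  also have "\<dots> = (\<Sum>v\<in>set w. count (mset w) v * (count A v - 1))"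
    by (simp add: sum_list_map_eq_sum_count count_mset)
  also have "\<dots> = M2"
    using assms by (metis M2_def permutations_of_multisetD set_mset_mset)
  finally show ?thesis .
qed

lemma M2_le: "M2 \<le> K * M"
proof -
  have "M2 \<le> (\<Sum>v\<in>set_mset A. count A v * K)"
    unfolding M2_def by (intro sum_mono mult_left_mono le_trans[OF diff_le_self count_le]) auto
  also have "\<dots> = K * M" by (simp add: sum_distrib_right[symmetric] size_multiset_overloaded_eq)
  finally show ?thesis .
qed

lemma block_pair_eqD: "{x, y} \<in> block_pairs \<Longrightarrow> x < M \<and> y < M \<and> x \<noteq> y \<and> x div r = y div r"
proof -
  assume "{x, y} \<in> block_pairs"
  then have "{x, y} \<subseteq> {..<M}" "card {x, y} = 2" "x div r = y div r"
    unfolding block_pairs_def by blast+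
  then show ?thesis by (cases "x = y") simp_all
qed

lemma finite_block_pairs: "finite block_pairs"
  by (rule finite_subset[of _ "Pow {..<M}"]) (auto simp: block_pairs_def)

lemma card_block_pairs: "card block_pairs = N * (r choose 2)"
proof -
  let ?B = "\<lambda>c. {p. p \<subseteq> {u. u div r = c} \<and> card p = 2}"
  have fin: "finite {u. u div r = c}" for c using finite_block[OF r_pos] by simp
  have "block_pairs = (\<Union>c<N. ?B c)"
  proof (intro set_eqI iffI)
    fix p assume "p \<in> block_pairs"
    then obtain x y where p: "p = {x, y}" "{x, y} \<in> block_pairs" and c2: "card p = 2"
      by (auto simp: block_pairs_def card_2_iff)
    note * = block_pair_eqD[OF p(2)]
    have "x div r < N" using * size_A r_pos by (simp add: less_mult_imp_div_less)
    then show "p \<in> (\<Union>c<N. ?B c)" using * p c2 by auto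
  next
    fix p assume "p \<in> (\<Union>c<N. ?B c)"
    then obtain c where c: "c < N" "p \<subseteq> {u. u div r = c}" "card p = 2" by auto
    have "x < M" if "x \<in> p" for x
    proof -
      have "x div r < N" using c that by auto
      then show ?thesis using size_A r_pos by (simp add: div_less_iff_less_mult)
    qed
    then show "p \<in> block_pairs" using c by (auto simp: block_pairs_def)
  qed
  moreover have "card (\<Union>c<N. ?B c) = (\<Sum>c<N. card (?B c))"
  proof (rule card_UN_disjoint)
    show "\<forall>i\<in>{..<N}. finite (?B i)" using fin by auto
    have "p \<noteq> {}" if "card p = 2" for p :: "nat set" using that by auto
    then show "\<forall>i\<in>{..<N}. \<forall>j\<in>{..<N}. i \<noteq> j \<longrightarrow> ?B i \<inter> ?B j = {}" by blast
  qed simp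
  moreover have "card (?B c) = r choose 2" for c
    using n_subsets[OF fin] card_block[OF r_pos] by simp
  ultimately show ?thesis by simp
qed

section \<open>Switchings that create no loops\<close>

text \<open>
  A swap between a position in \<open>D\<close> and a position \<open>s\<close> can create a loop in two ways: the vertex
  arriving in the block of \<open>D\<close> is there already, or the vertex leaving \<open>D\<close> occurs already in
  the block of \<open>s\<close>. The two sets collect these positions \<open>s\<close>. Each position lies in its own
  block, so the first set contains the whole block of every element of \<open>D\<close>.
\<close>

definition clashing :: "'a list \<Rightarrow> nat set \<Rightarrow> nat set" where
  "clashing w D = {s. s < M \<and> (\<exists>d\<in>D. \<exists>u<M. u div r = d div r \<and> w ! u = w ! s)}
     \<union> {s. s < M \<and> (\<exists>d\<in>D. \<exists>u<M. u div r = s div r \<and> w ! u = w ! d)}"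

lemma card_value_in_block_le:
  assumes w: "w \<in> words"
  shows "card {s. s < M \<and> (\<exists>u<M. u div r = c \<and> w ! u = w ! s)} \<le> r * K"
proof -
  have "card {s. s < M \<and> (\<exists>u<M. u div r = c \<and> w ! u = w ! s)}
       \<le> card (\<Union>u\<in>{u. u div r = c}. {s. s < M \<and> w ! s = w ! u})"
    by (intro card_mono) (use finite_block[OF r_pos] in auto)
  also have "\<dots> \<le> (\<Sum>u\<in>{u. u div r = c}. card {s. s < M \<and> w ! s = w ! u})"
    by (intro card_UN_le) (use finite_block[OF r_pos] in auto)
  also have "\<dots> \<le> (\<Sum>u\<in>{u. u div r = c}. K)"
    by (intro sum_mono card_fibre_le w)
  also have "\<dots> = r * K" using card_block[OF r_pos] by simp
  finally show ?thesis .
qed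

lemma card_block_contains_le:
  assumes w: "w \<in> words"
  shows "card {s. s < M \<and> (\<exists>u<M. u div r = s div r \<and> w ! u = v)} \<le> r * K"
proof -
  have "card {s. s < M \<and> (\<exists>u<M. u div r = s div r \<and> w ! u = v)}
       \<le> card (\<Union>u\<in>{u. u < M \<and> w ! u = v}. {s. s div r = u div r})"
    by (intro card_mono) (use finite_block[OF r_pos] in auto)
  also have "\<dots> \<le> (\<Sum>u\<in>{u. u < M \<and> w ! u = v}. card {s. s div r = u div r})"
    by (intro card_UN_le) auto
  also have "\<dots> = card {u. u < M \<and> w ! u = v} * r" using card_block[OF r_pos] by simp
  also have "\<dots> \<le> r * K" using card_fibre_le[OF w, of v] by simp
  finally show ?thesis .
qed

lemma card_clashing_single:
  assumes w: "w \<in> words"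
  shows "card (clashing w {d}) \<le> 2 * r * K"
  using card_Un_le[of "{s. s < M \<and> (\<exists>u<M. u div r = d div r \<and> w ! u = w ! s)}"
      "{s. s < M \<and> (\<exists>u<M. u div r = s div r \<and> w ! u = w ! d)}"]
    card_value_in_block_le[OF w, of "d div r"] card_block_contains_le[OF w, of "w ! d"]
  unfolding clashing_def by simp

text \<open>
  The bound is linear in \<open>r\<close> and \<open>K\<close>, and does not grow with the word: a block has \<open>r\<close>
  positions and a vertex occurs at most \<open>K\<close> times. This is why almost all positions can be used
  for switching when \<open>r * K\<close> is small compared with \<open>M\<close>.
\<close>

lemma card_clashing_pair:
  assumes w: "w \<in> words" and ab: "a div r = b div r"
  shows "card (clashing w {a, b}) \<le> 3 * r * K"
proof -
  let ?X = "{s. s < M \<and> (\<exists>u<M. u div r = a div r \<and> w ! u = w ! s)}"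
  let ?Y = "\<lambda>v. {s. s < M \<and> (\<exists>u<M. u div r = s div r \<and> w ! u = v)}"
  have "clashing w {a, b} = ?X \<union> (?Y (w ! a) \<union> ?Y (w ! b))"
    using ab by (auto simp: clashing_def)
  then show ?thesis
    using card_Un_le[of ?X "?Y (w ! a) \<union> ?Y (w ! b)"] card_Un_le[of "?Y (w ! a)" "?Y (w ! b)"]
      card_value_in_block_le[OF w, of "a div r"] card_block_contains_le[OF w, of "w ! a"] card_block_contains_le[OF w, of "w ! b"]
    by simp
qed

lemma finite_clashing [simp]: "finite (clashing w D)"
  by (simp add: clashing_def)

lemma same_block_clashing: "d \<in> D \<Longrightarrow> s < M \<Longrightarrow> s div r = d div r \<Longrightarrow> s \<in> clashing w D"
  by (auto simp: clashing_def)

lemma swap_avoiding: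
  assumes Q: "Q \<subseteq> block_pairs" and w: "w \<in> avoiding Q"
    and d: "d < M" and s: "s < M" "s \<notin> clashing w {d}"
  shows "swap_entries w d s \<in> avoiding Q"
proof -
  have W: "w \<in> words" and len: "length w = M" using w by (simp_all add: avoiding_word length_word)
  have "swap_entries w d s ! x \<noteq> swap_entries w d s ! y" if xy: "{x, y} \<in> Q" for x y
  proof -
    have *: "x < M" "y < M" "x \<noteq> y" "x div r = y div r" using Q xy block_pair_eqD by blast+
    have "w ! x \<noteq> w ! y" using w xy by (auto simp: avoiding_def)
    moreover have "s div r \<noteq> d div r" using s same_block_clashing by blast
    ultimately show ?thesis using * d s len by (auto simp: nth_swap_entries clashing_def)
  qed
  then show ?thesis using swap_word[OF W d s(1)] by (simp add: avoiding_def)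
qed

definition swap_both :: "nat \<Rightarrow> nat \<Rightarrow> 'a list \<Rightarrow> nat \<Rightarrow> nat \<Rightarrow> 'a list" where
  "swap_both a b w s t = swap_entries (swap_entries w a s) b t"

lemma nth_swap_both:
  assumes "w \<in> words" "a < M" "b < M" "s < M" "t < M" "distinct [a, b, s, t]"
  shows "swap_both a b w s t ! u =
     (if u = a then w ! s else if u = b then w ! t else if u = s then w ! a
      else if u = t then w ! b else w ! u)"
  using assms by (auto simp: swap_both_def nth_swap_entries length_word)

lemma swap_both_word:
  assumes "w \<in> words" "a < M" "b < M" "s < M" "t < M"
  shows "swap_both a b w s t \<in> words"
  using assms by (simp add: swap_both_def swap_word)

lemma swap_both_involutive:
  assumes "w \<in> words" "a < M" "b < M" "s < M" "t < M" "distinct [a, b, s, t]"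
  shows "swap_both a b (swap_both a b w s t) s t = w"
  by (rule nth_equalityI)
    (use assms in \<open>auto simp: nth_swap_both swap_both_word length_word\<close>)

lemma swap_both_inject:
  assumes "w \<in> words" "w' \<in> words" "a < M" "b < M" "s < M" "t < M" "distinct [a, b, s, t]"
    and "swap_both a b w s t = swap_both a b w' s t"
  shows "w = w'"
  using assms swap_both_involutive by metis

text \<open>
  The pair \<open>{a, b}\<close> is not yet forbidden, so it does not matter whether the vertices that
  arrive at \<open>a\<close> and \<open>b\<close> coincide. Likewise \<open>s\<close> and \<open>t\<close> may lie in one block as long as \<open>{s, t}\<close>
  is not forbidden, which is automatic if \<open>s\<close> and \<open>t\<close> carry the same vertex.
\<close>

lemma swap_both_avoiding:
  assumes Q: "Q \<subseteq> block_pairs" and ab: "{a, b} \<in> block_pairs - Q" and w: "w \<in> avoiding Q"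
    and st: "s < M" "t < M" "s \<noteq> t" "{s, t} \<notin> Q"
    and s: "s \<notin> clashing w {a, b}" and t: "t \<notin> clashing w {a, b}"
  shows "distinct [a, b, s, t]" and "swap_both a b w s t \<in> avoiding Q"
proof -
  have W: "w \<in> words" using w by (simp add: avoiding_word)
  have ab': "a < M" "b < M" "a \<noteq> b" "a div r = b div r" using ab block_pair_eqD by blast+
  have sb: "s div r \<noteq> b div r" "t div r \<noteq> b div r"
    using s t st same_block_clashing by blast+
  then show dist: "distinct [a, b, s, t]" using ab' st by auto
  note nth = nth_swap_both[OF W ab'(1,2) st(1,2) dist]
  \<comment> \<open>Only pairs that meet one of the four exchanged positions need an argument; as a forbidden pair it
     contains exactly one of them.\<close>
  have key: "swap_both a b w s t ! x \<noteq> swap_both a b w s t ! y"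
    if xy: "{x, y} \<in> Q" and case': "x = a \<or> x = b \<or> x = s \<or> x = t" for x y
  proof -
    have *: "x < M" "y < M" "x \<noteq> y" "x div r = y div r" using Q xy block_pair_eqD by blast+
    have "{x, y} \<noteq> {a, b}" "{x, y} \<noteq> {s, t}" using xy st ab by auto
    then have neq: "\<not> (x = a \<and> y = b)" "\<not> (x = b \<and> y = a)" "\<not> (x = s \<and> y = t)" "\<not> (x = t \<and> y = s)"
      by auto
    have c1: "w ! u \<noteq> w ! s" "w ! u \<noteq> w ! t" if "u < M" "u div r = b div r" for u
      using s t st that by (auto simp: clashing_def)
    have c2: "w ! u \<noteq> w ! a" "w ! u \<noteq> w ! b" if "u < M" "u div r = s div r \<or> u div r = t div r" for u
      using s t st that by (auto simp: clashing_def)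
    have y: "y \<noteq> a" "y \<noteq> b" "y \<noteq> s" "y \<noteq> t" using neq * sb ab' case' by auto
    have ny: "swap_both a b w s t ! y = w ! y" using y by (simp add: nth)
    from case' show ?thesis
      unfolding ny using dist c1[of y] c2[of y] * ab' by (auto simp: nth)
  qed
  have "swap_both a b w s t ! x \<noteq> swap_both a b w s t ! y" if xy: "{x, y} \<in> Q" for x y
  proof -
    have "{y, x} \<in> Q" using xy by (simp add: insert_commute)
    moreover have "w ! x \<noteq> w ! y" using w xy by (auto simp: avoiding_def)
    ultimately show ?thesis using key[OF xy] key[of y x] by (metis nth)
  qed
  then show "swap_both a b w s t \<in> avoiding Q"
    using swap_both_word[OF W ab'(1,2) st(1,2)] by (simp add: avoiding_def)
qed

section \<open>Conditional probability of one more loop\<close>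

text \<open>
  Divided by the number of avoiding words, this bounds the conditional probability of a loop at
  \<open>{a, b}\<close> by about \<open>M2 / M\<^sup>2\<close>. The double swap carries a word with a loop at \<open>{a, b}\<close> and an
  admissible pair \<open>(s, t)\<close> injectively to a word in which \<open>s\<close> and \<open>t\<close> carry the same vertex;
  every word has exactly \<open>M2\<close> such pairs. Clashing positions and pairs inside one block account
  for the at most \<open>7 * r * K * M\<close> inadmissible pairs.
\<close>

lemma coincidence_upper:
  assumes Q: "Q \<subseteq> block_pairs" and ab: "{a, b} \<in> block_pairs - Q"
  shows "card {w \<in> avoiding Q. w ! a = w ! b} * (M\<^sup>2 - 7 * r * K * M) \<le> card (avoiding Q) * M2"
proof -
  let ?B = "{w \<in> avoiding Q. w ! a = w ! b}"
  define G where "G w = {(s, t). s < M \<and> t < M \<and> s div r \<noteq> t div r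
      \<and> s \<notin> clashing w {a, b} \<and> t \<notin> clashing w {a, b}}" for w
  define C where "C w = {(s, t). s < M \<and> t < M \<and> s \<noteq> t \<and> w ! s = w ! t}" for w :: "'a list"
  have ab': "a < M" "b < M" "a \<noteq> b" "a div r = b div r" using ab block_pair_eqD by blast+
  have finC: "finite (C w)" and finG: "finite (G w)" for w
    by (rule finite_subset[of _ "{..<M} \<times> {..<M}"]; auto simp: C_def G_def)+
  have cardG: "M\<^sup>2 - 7 * r * K * M \<le> card (G w)" if "w \<in> ?B" for w
  proof -
    have W: "w \<in> words" using that avoiding_word by blast
    let ?Z = "clashing w {a, b}" and ?S = "SIGMA s:{..<M}. {t. t div r = s div r}"
    have fS: "finite ?S" using finite_block[OF r_pos] by auto
    have "{..<M} \<times> {..<M} \<subseteq> G w \<union> (?Z \<times> {..<M} \<union> ({..<M} \<times> ?Z \<union> ?S))"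
      by (auto simp: G_def)
    then have "card ({..<M} \<times> {..<M}) \<le> card (G w \<union> (?Z \<times> {..<M} \<union> ({..<M} \<times> ?Z \<union> ?S)))"
      using fS finG by (intro card_mono) auto
    also have "\<dots> \<le> card (G w) + (card (?Z \<times> {..<M}) + (card ({..<M} \<times> ?Z) + card ?S))"
      by (meson add_left_mono card_Un_le le_trans)
    also have "card ?S = M * r"
      using finite_block[OF r_pos] card_block[OF r_pos] by (subst card_SigmaI) auto
    also have "card (?Z \<times> {..<M}) = card ?Z * M" by (simp add: card_cartesian_product)
    also have "card ({..<M} \<times> ?Z) = card ?Z * M" by (simp add: card_cartesian_product)
    also have "card ({..<M} \<times> {..<M}) = M\<^sup>2" by (simp add: card_cartesian_product power2_eq_square)
    finally have "M\<^sup>2 \<le> card (G w) + (card ?Z * M + (card ?Z * M + M * r))" .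
    moreover have "card ?Z * M \<le> (3 * r * K) * M"
      by (intro mult_right_mono card_clashing_pair W ab') auto
    moreover have "M * r \<le> r * K * M" using K_pos by simp
    moreover have "3 * r * K * M + (3 * r * K * M + r * K * M) = 7 * r * K * M" by simp
    ultimately show ?thesis by linarith
  qed
  have inB: "distinct [a, b, s, t]" "swap_both a b w s t \<in> avoiding Q" "w \<in> words" "s < M" "t < M"
    "w ! a = w ! b"
    if "w \<in> ?B" "(s, t) \<in> G w" for w s t
  proof -
    have "{s, t} \<notin> Q" using that(2) block_pair_eqD[of s t] Q by (auto simp: G_def)
    moreover have "s \<noteq> t" using that(2) by (auto simp: G_def)
    ultimately show "distinct [a, b, s, t]" "swap_both a b w s t \<in> avoiding Q"
      using swap_both_avoiding[OF Q ab, of w s t] that by (auto simp: G_def)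
    show "w \<in> words" "s < M" "t < M" "w ! a = w ! b" using that by (auto simp: G_def avoiding_def)
  qed
  have "card ?B * (M\<^sup>2 - 7 * r * K * M) = (\<Sum>w\<in>?B. M\<^sup>2 - 7 * r * K * M)" by simp
  also have "\<dots> \<le> (\<Sum>w\<in>?B. card (G w))" by (intro sum_mono cardG)
  also have "\<dots> = card (SIGMA w:?B. G w)" by (subst card_SigmaI) (auto simp: finG)
  also have "\<dots> \<le> card (SIGMA w:avoiding Q. C w)"
  proof (rule card_inj_on_le)
    let ?f = "\<lambda>(w, s, t). (swap_both a b w s t, s, t)"
    show "inj_on ?f (SIGMA w:?B. G w)"
    proof (clarsimp simp: inj_on_def)
      fix w w' s t
      assume "w \<in> avoiding Q" "w ! a = w ! b" "(s, t) \<in> G w" "w' \<in> avoiding Q" "w' ! a = w' ! b" "(s, t) \<in> G w'"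
        and eq: "swap_both a b w s t = swap_both a b w' s t"
      then show "w = w'"
        using inB[of w s t] inB[of w' s t] ab' by (intro swap_both_inject[OF _ _ _ _ _ _ _ eq]) auto
    qed
    show "?f ` (SIGMA w:?B. G w) \<subseteq> (SIGMA w:avoiding Q. C w)"
    proof (clarsimp, intro conjI)
      fix w s t assume "w \<in> avoiding Q" "w ! a = w ! b" and st: "(s, t) \<in> G w"
      then have "w \<in> ?B" by simp
      note i = inB[OF this st]
      then show "swap_both a b w s t \<in> avoiding Q" by simp
      show "(s, t) \<in> C (swap_both a b w s t)"
        using i ab' by (auto simp: C_def nth_swap_both)
    qed
    show "finite (SIGMA w:avoiding Q. C w)" using finC by auto
  qed
  also have "\<dots> = (\<Sum>w\<in>avoiding Q. card (C w))" by (subst card_SigmaI) (auto simp: finC)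
  also have "\<dots> = card (avoiding Q) * M2"
    unfolding C_def by (simp add: card_coincidences avoiding_word)
  finally show ?thesis .
qed

text \<open>
  The converse count uses the same switching from the other end: start from a pair \<open>(s, t)\<close>
  carrying the same vertex and move both entries to \<open>a\<close> and \<open>b\<close>. The loss is only of order
  \<open>r * K\<^sup>2\<close>, since a clashing \<open>s\<close> leaves at most \<open>K\<close> choices of \<open>t\<close>.
\<close>

lemma coincidence_lower:
  assumes Q: "Q \<subseteq> block_pairs" and ab: "{a, b} \<in> block_pairs - Q"
  shows "card (avoiding Q) * (M2 - 6 * r * K\<^sup>2) \<le> card {w \<in> avoiding Q. w ! a = w ! b} * M\<^sup>2"
proof -
  let ?B = "{w \<in> avoiding Q. w ! a = w ! b}"
  define C where "C w = {(s, t). s < M \<and> t < M \<and> s \<noteq> t \<and> w ! s = w ! t}" for w :: "'a list"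
  define G where "G w = {(s, t) \<in> C w. s \<notin> clashing w {a, b} \<and> t \<notin> clashing w {a, b}}" for w
  have ab': "a < M" "b < M" "a \<noteq> b" "a div r = b div r" using ab block_pair_eqD by blast+
  have finC: "finite (C w)" for w
    by (rule finite_subset[of _ "{..<M} \<times> {..<M}"]) (auto simp: C_def)
  have finG: "finite (G w)" for w using finC by (rule rev_finite_subset) (auto simp: G_def)
  have cardG: "M2 - 6 * r * K\<^sup>2 \<le> card (G w)" if "w \<in> avoiding Q" for w
  proof -
    have W: "w \<in> words" using that avoiding_word by blast
    let ?Z = "clashing w {a, b}"
    let ?S = "SIGMA s:?Z. {t. t < M \<and> w ! t = w ! s}"
    have fS: "finite ?S" by auto
    have cS: "card ?S \<le> 3 * r * K * K"
    proof -
      have "card ?S = (\<Sum>s\<in>?Z. card {t. t < M \<and> w ! t = w ! s})" by (subst card_SigmaI) auto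
      also have "\<dots> \<le> (\<Sum>s\<in>?Z. K)" by (intro sum_mono card_fibre_le W)
      also have "\<dots> \<le> 3 * r * K * K" using card_clashing_pair[OF W ab'(4)] by simp
      finally show ?thesis .
    qed
    have "C w \<subseteq> G w \<union> (?S \<union> prod.swap ` ?S)"
      by (auto simp: G_def C_def image_iff)
    then have "card (C w) \<le> card (G w \<union> (?S \<union> prod.swap ` ?S))"
      using fS finG by (intro card_mono) auto
    also have "\<dots> \<le> card (G w) + (card ?S + card ?S)"
      using card_Un_le[of "G w" "?S \<union> prod.swap ` ?S"] card_Un_le[of ?S "prod.swap ` ?S"]
        card_image_le[OF fS, of prod.swap] by linarith
    finally show ?thesis using cS card_coincidences[OF W] by (simp add: C_def power2_eq_square)
  qed
  have inG: "distinct [a, b, s, t]" "swap_both a b w s t \<in> avoiding Q" "w \<in> words" "s < M" "t < M"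
    "w ! s = w ! t"
    if "w \<in> avoiding Q" "(s, t) \<in> G w" for w s t
  proof -
    have st: "s < M" "t < M" "s \<noteq> t" "w ! s = w ! t" using that(2) by (auto simp: G_def C_def)
    then have "{s, t} \<notin> Q" using that(1) by (auto simp: avoiding_def)
    with st show "distinct [a, b, s, t]" "swap_both a b w s t \<in> avoiding Q"
      using swap_both_avoiding[OF Q ab, of w s t] that by (auto simp: G_def)
    show "w \<in> words" "s < M" "t < M" "w ! s = w ! t" using that st by (auto simp: avoiding_def)
  qed
  have "card (avoiding Q) * (M2 - 6 * r * K\<^sup>2) = (\<Sum>w\<in>avoiding Q. M2 - 6 * r * K\<^sup>2)" by simp
  also have "\<dots> \<le> (\<Sum>w\<in>avoiding Q. card (G w))" by (intro sum_mono cardG)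
  also have "\<dots> = card (SIGMA w:avoiding Q. G w)" by (subst card_SigmaI) (auto simp: finG)
  also have "\<dots> \<le> card (?B \<times> ({..<M} \<times> {..<M}))"
  proof (rule card_inj_on_le)
    let ?f = "\<lambda>(w, s, t). (swap_both a b w s t, s, t)"
    show "inj_on ?f (SIGMA w:avoiding Q. G w)"
    proof (clarsimp simp: inj_on_def)
      fix w w' s t
      assume "w \<in> avoiding Q" "(s, t) \<in> G w" "w' \<in> avoiding Q" "(s, t) \<in> G w'"
        and eq: "swap_both a b w s t = swap_both a b w' s t"
      then show "w = w'"
        using inG[of w s t] inG[of w' s t] ab' by (intro swap_both_inject[OF _ _ _ _ _ _ _ eq]) auto
    qed
    show "?f ` (SIGMA w:avoiding Q. G w) \<subseteq> ?B \<times> ({..<M} \<times> {..<M})"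
    proof (clarsimp, intro conjI)
      fix w s t assume "w \<in> avoiding Q" "(s, t) \<in> G w"
      note i = inG[OF this]
      then show "swap_both a b w s t \<in> avoiding Q" "s < M" "t < M" by simp_all
      show "swap_both a b w s t ! a = swap_both a b w s t ! b"
        using i ab' by (auto simp: nth_swap_both)
    qed
  qed auto
  also have "\<dots> = card ?B * M\<^sup>2" by (simp add: card_cartesian_product power2_eq_square)
  finally show ?thesis .
qed

text \<open>
  A prescribed coincidence \<open>w ! d = w ! c\<close> has conditional probability about \<open>K / M\<close> at most,
  even given an event \<open>E\<close> that depends only on the positions in \<open>X\<close>: exchanging \<open>d\<close> with a
  random position \<open>s\<close> outside \<open>X\<close> preserves \<open>E\<close>, and afterwards \<open>s\<close> is one of the at most \<open>K\<close>
  positions with the vertex of \<open>c\<close>.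
\<close>

lemma single_swap_bound:
  assumes Q: "Q \<subseteq> block_pairs" and d: "d < M" "d \<notin> X" and c: "c \<in> X" "X \<subseteq> {..<M}"
    and E: "\<And>w w'. (\<And>x. x \<in> X \<Longrightarrow> w ! x = w' ! x) \<Longrightarrow> E w \<longleftrightarrow> E w'"
  shows "card {w \<in> avoiding Q. E w \<and> w ! d = w ! c} * (M - (2 * r * K + card X))
     \<le> card {w \<in> avoiding Q. E w} * K"
proof -
  let ?F = "{w \<in> avoiding Q. E w}" and ?B = "{w \<in> avoiding Q. E w \<and> w ! d = w ! c}"
  have finX: "finite X" using c finite_subset by blast
  define G where "G w = {..<M} - (clashing w {d} \<union> X)" for w
  have cardG: "M - (2 * r * K + card X) \<le> card (G w)" if "w \<in> ?B" for w
  proof -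
    have "card (clashing w {d} \<union> X) \<le> 2 * r * K + card X"
      using card_Un_le[of "clashing w {d}" X] card_clashing_single[of w d] that avoiding_word by force
    moreover have "M - card (clashing w {d} \<union> X) \<le> card (G w)"
      unfolding G_def using diff_card_le_card_Diff[of "clashing w {d} \<union> X" "{..<M}"] finX by simp
    ultimately show ?thesis by linarith
  qed
  have "card ?B * (M - (2 * r * K + card X)) = (\<Sum>w\<in>?B. M - (2 * r * K + card X))" by simp
  also have "\<dots> \<le> (\<Sum>w\<in>?B. card (G w))" by (intro sum_mono cardG)
  also have "\<dots> = card (SIGMA w:?B. G w)" by (subst card_SigmaI) (auto simp: G_def)
  also have "\<dots> \<le> card (SIGMA w:?F. {s. s < M \<and> w ! s = w ! c})"
  proof (rule card_inj_on_le)
    let ?f = "\<lambda>(w, s). (swap_entries w d s, s)"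
    show "inj_on ?f (SIGMA w:?B. G w)"
    proof (clarsimp simp: inj_on_def)
      fix w w' s
      assume "w \<in> avoiding Q" "s \<in> G w" "w' \<in> avoiding Q"
        and eq: "swap_entries w d s = swap_entries w' d s"
      then have "s < M" "length w = M" "length w' = M"
        by (simp_all add: G_def avoiding_word length_word)
      then show "w = w'" using d eq swap_entries_involutive by metis
    qed
    show "?f ` (SIGMA w:?B. G w) \<subseteq> (SIGMA w:?F. {s. s < M \<and> w ! s = w ! c})"
    proof (clarsimp, intro conjI)
      fix w s assume w: "w \<in> avoiding Q" "E w" "w ! d = w ! c" and s: "s \<in> G w"
      have len: "length w = M" and sM: "s < M" and sX: "s \<notin> X"
        using w s by (auto simp: G_def avoiding_word length_word)
      have nth: "swap_entries w d s ! x = w ! x" if "x \<in> X" for x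
        using that d sX sM len by (auto simp: nth_swap_entries)
      show "swap_entries w d s \<in> avoiding Q"
        using s by (intro swap_avoiding Q w d) (auto simp: G_def)
      show "E (swap_entries w d s)" using E[of "swap_entries w d s" w] nth w by blast
      show "s < M" by fact
      show "swap_entries w d s ! s = swap_entries w d s ! c"
        using nth[OF c(1)] w sM len d by (auto simp: nth_swap_entries)
    qed
  qed auto
  also have "\<dots> = (\<Sum>w\<in>?F. card {s. s < M \<and> w ! s = w ! c})" by (subst card_SigmaI) auto
  also have "\<dots> \<le> (\<Sum>w\<in>?F. K)" by (intro sum_mono card_fibre_le) (auto simp: avoiding_word)
  finally show ?thesis by simp
qed

lemma avoiding_insert:
  "avoiding (insert {a, b} Q) = avoiding Q - {w \<in> avoiding Q. w ! a = w ! b}"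
  by (auto simp: avoiding_def doubleton_eq_iff)

section \<open>The number of loop-free words\<close>

text \<open>
  The chain rule for conditional probabilities: each newly forbidden pair multiplies the number
  of words by one minus its conditional probability, which lies between \<open>x\<close> and \<open>y\<close>.
\<close>

lemma avoiding_bounds:
  fixes x y :: real
  assumes "Q \<subseteq> block_pairs" and M: "7 * r * K < M"
    and x: "x * (real M)\<^sup>2 \<le> real M2 - 6 * real r * (real K)\<^sup>2" "x \<le> 1"
    and y: "real M2 \<le> y * ((real M)\<^sup>2 - 7 * real r * real K * real M)" "y \<le> 1"
  shows "(1 - y) ^ card Q * card words \<le> card (avoiding Q)"
    and "card (avoiding Q) \<le> (1 - x) ^ card Q * card words"
proof -
  have "finite Q" using assms(1) finite_block_pairs finite_subset by blast
  then have "(1 - y) ^ card Q * card words \<le> card (avoiding Q) \<and>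
      card (avoiding Q) \<le> (1 - x) ^ card Q * card words"
    using assms(1)
  proof (induction Q rule: finite_induct)
    case empty
    then show ?case by (simp add: avoiding_def)
  next
    case (insert p Q)
    then have Q: "Q \<subseteq> block_pairs" and p: "p \<in> block_pairs - Q" by auto
    obtain a b where ab: "p = {a, b}" using p by (auto simp: block_pairs_def card_2_iff)
    note p' = p[unfolded ab]
    let ?B = "{w \<in> avoiding Q. w ! a = w ! b}"
    have sub: "?B \<subseteq> avoiding Q" by auto
    have "card ?B \<le> card (avoiding Q)" by (intro card_mono) auto
    then have eq: "real (card (avoiding (insert p Q))) = real (card (avoiding Q)) - real (card ?B)"
      unfolding ab avoiding_insert by (subst card_Diff_subset[OF _ sub]) auto
    have pos: "0 < (real M)\<^sup>2 - 7 * real r * real K * real M"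
    proof -
      have "7 * real r * real K < real M" using M
        by (simp only: of_nat_mult of_nat_numeral flip: of_nat_less_iff[where 'a = real])
      then have "0 < real M * (real M - 7 * real r * real K)"
        using le_less_trans[OF le0 M] by (intro mult_pos_pos) auto
      then show ?thesis by (simp add: algebra_simps power2_eq_square)
    qed
    have "real (card ?B) \<le> y * real (card (avoiding Q))"
    proof -
      have "7 * r * K * M \<le> M\<^sup>2" using M by (simp add: power2_eq_square)
      then have "real (M\<^sup>2 - 7 * r * K * M) = (real M)\<^sup>2 - 7 * real r * real K * real M"
        by (simp add: of_nat_diff)
      then have "real (card ?B) * ((real M)\<^sup>2 - 7 * real r * real K * real M)
           \<le> real (card (avoiding Q)) * real M2"
        using of_nat_mono[OF coincidence_upper[OF Q p'], where 'a = real] by (simp only: of_nat_mult)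
      also have "\<dots> \<le> real (card (avoiding Q)) * (y * ((real M)\<^sup>2 - 7 * real r * real K * real M))"
        by (intro mult_left_mono y) auto
      finally have "real (card ?B) * ((real M)\<^sup>2 - 7 * real r * real K * real M)
           \<le> (y * real (card (avoiding Q))) * ((real M)\<^sup>2 - 7 * real r * real K * real M)"
        by (simp add: ac_simps)
      then show ?thesis using pos by simp
    qed
    moreover have "x * real (card (avoiding Q)) \<le> real (card ?B)"
    proof -
      have Mpos: "0 < (real M)\<^sup>2" using M by auto
      have "M2 \<le> (M2 - 6 * r * K\<^sup>2) + 6 * r * K\<^sup>2" by simp
      then have "real M2 \<le> real (M2 - 6 * r * K\<^sup>2) + 6 * real r * (real K)\<^sup>2"
        by (simp only: of_nat_mult of_nat_power of_nat_numeral of_nat_add flip: of_nat_le_iff[where 'a = real])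
      then have "real M2 - 6 * real r * (real K)\<^sup>2 \<le> real (M2 - 6 * r * K\<^sup>2)" by linarith
      then have "(x * real (card (avoiding Q))) * (real M)\<^sup>2 \<le> real (card (avoiding Q)) * real (M2 - 6 * r * K\<^sup>2)"
        using x(1) mult_left_mono[of "x * (real M)\<^sup>2" "real (M2 - 6 * r * K\<^sup>2)" "real (card (avoiding Q))"]
        by (simp add: ac_simps)
      also have "\<dots> \<le> real (card ?B) * (real M)\<^sup>2"
        using of_nat_mono[OF coincidence_lower[OF Q p'], where 'a = real]
        by (simp only: of_nat_mult of_nat_power)
      finally show ?thesis using Mpos by simp
    qed
    moreover have "(1 - y) * ((1 - y) ^ card Q * card words) \<le> (1 - y) * card (avoiding Q)"
      using insert.IH[OF Q] y by (intro mult_left_mono) auto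
    moreover have "(1 - x) * card (avoiding Q) \<le> (1 - x) * ((1 - x) ^ card Q * card words)"
      using insert.IH[OF Q] x by (intro mult_left_mono) auto
    ultimately show ?case
      using insert.hyps eq by (simp add: algebra_simps)
  qed
  then show "(1 - y) ^ card Q * card words \<le> card (avoiding Q)"
    and "card (avoiding Q) \<le> (1 - x) ^ card Q * card words" by auto
qed

lemma real_size_A: "real M = real N * real r"
  using size_A by simp

text \<open>
  If all conditional probabilities are within \<open>O(r * K\<^sup>2 / M\<^sup>2)\<close> of \<open>M2 / M\<^sup>2\<close>, then the
  product over the \<open>M * (r - 1) / 2\<close> block pairs has logarithm \<open>- (r - 1) * M2 / (2 * M)\<close> up to
  \<open>O(r\<^sup>2 * K\<^sup>2 / M)\<close>. The quadratic term of the logarithm is absorbed because \<open>z = O(K / M)\<close>.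
\<close>

lemma ln_power_estimate:
  fixes z :: real
  assumes M: "28 * r * K \<le> M" "0 < M"
    and z: "\<bar>z - M2 / (real M)\<^sup>2\<bar> \<le> 14 * real r * (real K)\<^sup>2 / (real M)\<^sup>2"
  shows "z \<le> 1 / 2"
    and "\<bar>card block_pairs * ln (1 - z) + (real r - 1) * M2 / (2 * M)\<bar> \<le> 10 * (real r)\<^sup>2 * (real K)\<^sup>2 / M"
proof -
  define m where "m = real M"
  define k where "k = real K"
  define s where "s = real r"
  have pos: "m > 0" "k \<ge> 1" "s \<ge> 1" using M K_pos r_pos by (auto simp: m_def k_def s_def)
  have Ms: "28 * s * k \<le> m" using M(1) unfolding m_def s_def k_def
    by (simp only: of_nat_mult of_nat_numeral flip: of_nat_le_iff[where 'a = real])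
  have q: "0 \<le> M2 / m\<^sup>2" "M2 / m\<^sup>2 \<le> k / m"
  proof -
    have "real M2 \<le> k * m" using of_nat_mono[OF M2_le, where 'a = real] unfolding k_def m_def by (simp only: of_nat_mult)
    then show "M2 / m\<^sup>2 \<le> k / m" using pos by (simp add: field_simps power2_eq_square)
  qed simp
  have "14 * s * k\<^sup>2 / m\<^sup>2 \<le> 1 / 2 * (k / m)"
  proof -
    have "28 * s * k * k \<le> m * k" using Ms pos by (intro mult_right_mono) auto
    then show ?thesis using pos by (simp add: field_simps power2_eq_square)
  qed
  then have absz: "\<bar>z\<bar> \<le> 3 / 2 * (k / m)"
    using z q unfolding m_def[symmetric] k_def[symmetric] s_def[symmetric] by linarith
  have km: "k / m \<le> 1 / 28"
  proof -
    have "28 * k \<le> 28 * s * k" using pos by simp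
    then have "28 * k \<le> m" using Ms by linarith
    then show ?thesis using pos by (simp add: field_simps)
  qed
  have half: "\<bar>z\<bar> \<le> 1 / 2" using absz km by linarith
  then show "z \<le> 1 / 2" by simp
  have "\<bar>ln (1 - z) + z\<bar> \<le> 2 * z\<^sup>2"
    using abs_ln_one_plus_x_minus_x_bound[of "- z"] half by simp
  moreover have "z\<^sup>2 \<le> (3 / 2 * (k / m))\<^sup>2" using absz pos by (intro abs_le_square_iff[THEN iffD1]) auto
  then have "z\<^sup>2 \<le> 9 / 4 * (k\<^sup>2 / m\<^sup>2)" by (simp add: power_mult_distrib power_divide)
  moreover have "k\<^sup>2 / m\<^sup>2 \<le> s * k\<^sup>2 / m\<^sup>2" using pos by (intro divide_right_mono) auto
  moreover have "\<bar>z - M2 / m\<^sup>2\<bar> \<le> 14 * (s * k\<^sup>2 / m\<^sup>2)"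
    using z by (simp add: m_def k_def s_def)
  moreover have "0 \<le> s * k\<^sup>2 / m\<^sup>2" using pos by simp
  ultimately have est: "\<bar>ln (1 - z) + M2 / m\<^sup>2\<bar> \<le> 20 * (s * k\<^sup>2 / m\<^sup>2)"
    by linarith
  have c: "real (card block_pairs) = m * (s - 1) / 2"
  proof -
    have "real (r choose 2) = s * (s - 1) / 2"
      using r_pos by (simp add: s_def choose_two real_of_nat_div of_nat_diff)
    then show ?thesis by (simp add: card_block_pairs m_def s_def real_size_A)
  qed
  have "\<bar>card block_pairs * ln (1 - z) + (s - 1) * M2 / (2 * m)\<bar>
      = m * (s - 1) / 2 * \<bar>ln (1 - z) + M2 / m\<^sup>2\<bar>"
  proof -
    have "card block_pairs * ln (1 - z) + (s - 1) * M2 / (2 * m)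
        = m * (s - 1) / 2 * (ln (1 - z) + M2 / m\<^sup>2)"
      unfolding c using pos by (simp add: field_simps power2_eq_square)
    moreover have "0 \<le> m * (s - 1) / 2" using pos by simp
    ultimately show ?thesis by (simp only: abs_mult abs_of_nonneg)
  qed
  also have "\<dots> \<le> m * s / 2 * (20 * (s * k\<^sup>2 / m\<^sup>2))"
    using est pos by (intro mult_mono) auto
  also have "\<dots> = 10 * s\<^sup>2 * k\<^sup>2 / m" using pos by (simp add: field_simps power2_eq_square)
  finally show "\<bar>card block_pairs * ln (1 - z) + (real r - 1) * M2 / (2 * M)\<bar>
      \<le> 10 * (real r)\<^sup>2 * (real K)\<^sup>2 / M" by (simp add: m_def k_def s_def)
qed

lemma card_loop_free_estimate:
  assumes M: "28 * r * K \<le> M" "0 < M"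
  defines "c \<equiv> - ((real r - 1) * M2 / (2 * M))"
  defines "\<delta> \<equiv> 10 * (real r)\<^sup>2 * (real K)\<^sup>2 / M"
  shows "card words * exp (c - \<delta>) \<le> card (avoiding block_pairs)"
    and "card (avoiding block_pairs) \<le> card words * exp (c + \<delta>)"
proof -
  define q where "q = M2 / (real M)\<^sup>2"
  \<comment> \<open>Both coincidence bounds place the conditional probability within \<open>h\<close> of \<open>q\<close>.\<close>
  define h where "h = 14 * real r * (real K)\<^sup>2 / (real M)\<^sup>2"
  have h0: "0 \<le> h" by (simp add: h_def)
  have est: "z \<le> 1 / 2" "\<bar>card block_pairs * ln (1 - z) - c\<bar> \<le> \<delta>" if "\<bar>z - q\<bar> \<le> h" for z
    using ln_power_estimate[OF M, of z] that by (simp_all add: q_def h_def c_def \<delta>_def)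
  have pow: "(1 - z) ^ card block_pairs = exp (card block_pairs * ln (1 - z))" if "z \<le> 1 / 2" for z :: real
    using that by (simp add: exp_of_nat_mult)
  have M7: "7 * r * K < M"
  proof -
    have "0 < r * K" using r_pos K_pos by simp
    then show ?thesis using M(1) by linarith
  qed
  have Mpos: "A \<noteq> {#}" using M by auto
  have m: "real M > 0" using M by simp
  have x: "(q - h) * (real M)\<^sup>2 \<le> real M2 - 6 * real r * (real K)\<^sup>2"
    using m Mpos by (auto simp: q_def h_def field_simps simp flip: size_eq_0_iff_empty)
  have y: "real M2 \<le> (q + h) * ((real M)\<^sup>2 - 7 * real r * real K * real M)"
  proof -
    have M28: "28 * real r * real K \<le> real M"
      using of_nat_mono[OF M(1), where 'a = real] by (simp only: of_nat_mult of_nat_numeral)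
    have "7 * real r * real K * real M2 \<le> 7 * real r * real K * (real K * real M)"
      using M2_le by (intro mult_left_mono) (auto simp flip: of_nat_mult)
    then have a: "7 * real r * real K * real M2 / real M \<le> 7 * real r * (real K)\<^sup>2"
      using m by (simp add: field_simps power2_eq_square)
    have "0 \<le> real r * real K" by simp
    then have "14 * real r * real K \<le> real M" using M28 by linarith
    then have "14 * real r * real K * (7 * real r * (real K)\<^sup>2) \<le> real M * (7 * real r * (real K)\<^sup>2)"
      by (intro mult_right_mono) auto
    then have b: "98 * (real r)\<^sup>2 * (real K)^3 / real M \<le> 7 * real r * (real K)\<^sup>2"
      using m by (simp add: field_simps power2_eq_square power3_eq_cube)
    have expand: "(u / m\<^sup>2 + 14 * s * k\<^sup>2 / m\<^sup>2) * (m\<^sup>2 - 7 * s * k * m)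
       = u + 14 * s * k\<^sup>2 - 7 * s * k * u / m - 98 * s\<^sup>2 * k ^ 3 / m" if "0 < m" for u s k m :: real
      using that by (simp add: field_simps power2_eq_square power3_eq_cube)
    have "(q + h) * ((real M)\<^sup>2 - 7 * real r * real K * real M)
       = real M2 + 14 * real r * (real K)\<^sup>2 - 7 * real r * real K * real M2 / real M
         - 98 * (real r)\<^sup>2 * (real K)^3 / real M"
      unfolding q_def h_def by (rule expand[OF m])
    then show ?thesis using a b by linarith
  qed
  have lu: "\<bar>(q - h) - q\<bar> \<le> h" "\<bar>(q + h) - q\<bar> \<le> h" using h0 by auto
  note bnd = avoiding_bounds[OF order_refl M7 x _ y]
  have le1: "q - h \<le> 1" "q + h \<le> 1" using est(1)[OF lu(1)] est(1)[OF lu(2)] by auto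
  have "card words * exp (c - \<delta>) \<le> card words * exp (card block_pairs * ln (1 - (q + h)))"
    using est(2)[OF lu(2)] by (intro mult_left_mono) auto
  also have "\<dots> \<le> card (avoiding block_pairs)"
    using bnd(1) le1 pow[OF est(1)[OF lu(2)]] by (simp add: mult.commute)
  finally show "card words * exp (c - \<delta>) \<le> card (avoiding block_pairs)" .
  have "card (avoiding block_pairs) \<le> card words * exp (card block_pairs * ln (1 - (q - h)))"
    using bnd(2) le1 pow[OF est(1)[OF lu(1)]] by (simp add: mult.commute)
  also have "\<dots> \<le> card words * exp (c + \<delta>)"
    using est(2)[OF lu(1)] by (intro mult_left_mono) auto
  finally show "card (avoiding block_pairs) \<le> card words * exp (c + \<delta>)" .
qed

section \<open>Repeated edges\<close>

definition block :: "'a list \<Rightarrow> nat \<Rightarrow> 'a list" where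
  "block w c = map (\<lambda>i. w ! (c * r + i)) [0..<r]"

definition simple_words :: "'a list set" where
  "simple_words = {w \<in> avoiding block_pairs. inj_on (\<lambda>c. mset (block w c)) {..<N}}"

lemma position_less: "c < N \<Longrightarrow> j < r \<Longrightarrow> c * r + j < M"
proof -
  assume "c < N" "j < r"
  then have "c * r + j < Suc c * r" "Suc c * r \<le> N * r" using mult_le_mono1[of "Suc c" N r] by auto
  then show ?thesis unfolding size_A by (rule less_le_trans)
qed

text \<open>
  Three coincidences suffice to make repeated edges rare, and \<open>r \<ge> 3\<close> provides them. They are
  imposed one after the other with \<open>single_swap_bound\<close>, each costing a factor \<open>2 * K / M\<close>; the
  fixed positions are at most \<open>5\<close> in number.
\<close>

lemma card_triple_match:
  assumes r3: "3 \<le> r" and M: "14 * r * K \<le> M"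
    and lt: "p0 < M" "p1 < M" "p2 < M" "q0 < M" "q1 < M" "q2 < M"
    and ne: "distinct [q0, q1, q2]" "{q0, q1, q2} \<inter> {p0, p1, p2} = {}"
  shows "card {w \<in> avoiding block_pairs. w ! q0 = w ! p0 \<and> w ! q1 = w ! p1 \<and> w ! q2 = w ! p2} * M ^ 3
     \<le> card (avoiding block_pairs) * (2 * K) ^ 3"
proof -
  let ?L = "avoiding block_pairs"
  have step: "card {w \<in> ?L. E w \<and> w ! d = w ! c} * M \<le> card {w \<in> ?L. E w} * (2 * K)"
    if X: "d < M" "d \<notin> X" "c \<in> X" "X \<subseteq> {..<M}" "card X \<le> 5"
      and E: "\<And>w w'. (\<And>x. x \<in> X \<Longrightarrow> w ! x = w' ! x) \<Longrightarrow> E w \<longleftrightarrow> E w'" for E d c X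
  proof -
    have "3 * 1 \<le> r * K" using r3 K_pos by (intro mult_le_mono) auto
    then have "M \<le> 2 * (M - (2 * r * K + card X))" using M X(5) by simp
    then have "card {w \<in> ?L. E w \<and> w ! d = w ! c} * M
       \<le> card {w \<in> ?L. E w \<and> w ! d = w ! c} * (2 * (M - (2 * r * K + card X)))"
      by (intro mult_left_mono) auto
    also have "\<dots> \<le> card {w \<in> ?L. E w} * (2 * K)"
      using single_swap_bound[OF order_refl X(1-4) E] by simp
    finally show ?thesis .
  qed
  have 1: "card {w \<in> ?L. True \<and> w ! q0 = w ! p0} * M \<le> card {w \<in> ?L. True} * (2 * K)"
    by (rule step[where X = "{p0}"]) (use lt ne in auto)
  have 2: "card {w \<in> ?L. w ! q0 = w ! p0 \<and> w ! q1 = w ! p1} * M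
     \<le> card {w \<in> ?L. w ! q0 = w ! p0} * (2 * K)"
  proof (rule step[where X = "{p0, p1, q0}"])
    show "card {p0, p1, q0} \<le> 5" using card_length[of "[p0, p1, q0]"] by simp
  qed (use lt ne in auto)
  have 3: "card {w \<in> ?L. (w ! q0 = w ! p0 \<and> w ! q1 = w ! p1) \<and> w ! q2 = w ! p2} * M
     \<le> card {w \<in> ?L. w ! q0 = w ! p0 \<and> w ! q1 = w ! p1} * (2 * K)"
  proof (rule step[where X = "{p0, p1, p2, q0, q1}"])
    show "card {p0, p1, p2, q0, q1} \<le> 5" using card_length[of "[p0, p1, p2, q0, q1]"] by simp
  qed (use lt ne in auto)
  \<comment> \<open>The three bounds telescope.\<close>
  have alg: "a3 * m ^ 3 \<le> l * k ^ 3" if "a1 * m \<le> l * k" "a2 * m \<le> a1 * k" "a3 * m \<le> a2 * k"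
    for a1 a2 a3 l m k :: nat
  proof -
    have "a3 * m ^ 3 = (a3 * m) * m\<^sup>2" by (simp add: power3_eq_cube power2_eq_square)
    also have "\<dots> \<le> (a2 * k) * m\<^sup>2" by (intro mult_right_mono that) auto
    also have "\<dots> = (a2 * m) * (k * m)" by (simp add: power2_eq_square)
    also have "\<dots> \<le> (a1 * k) * (k * m)" by (intro mult_right_mono that) auto
    also have "\<dots> = (a1 * m) * k\<^sup>2" by (simp add: power2_eq_square)
    also have "\<dots> \<le> (l * k) * k\<^sup>2" by (intro mult_right_mono that) auto
    finally show ?thesis by (simp add: power3_eq_cube power2_eq_square)
  qed
  show ?thesis
    using alg[OF 1[unfolded simp_thms] 2 3] by (simp only: conj_assoc simp_thms Collect_mem_eq)
qed

text \<open>
  If two blocks coincide as multisets, then the first three positions of one of them carry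
  vertices of the other: there are at most \<open>N\<^sup>2\<close> pairs of blocks and \<open>r ^ 3\<close> choices of the
  matching positions.
\<close>

lemma card_not_simple:
  assumes r3: "3 \<le> r" and M: "14 * r * K \<le> M"
  shows "card (avoiding block_pairs - simple_words) * M ^ 3
     \<le> (N\<^sup>2 * r ^ 3) * (card (avoiding block_pairs) * (2 * K) ^ 3)"
proof -
  let ?L = "avoiding block_pairs"
  define T where "T = (\<lambda>((c, d), j0, j1, j2). {w \<in> ?L. w ! (d * r) = w ! (c * r + j0)
      \<and> w ! (d * r + 1) = w ! (c * r + j1) \<and> w ! (d * r + 2) = w ! (c * r + j2)})"
  let ?I = "{(c, d). c < N \<and> d < N \<and> c \<noteq> d} \<times> {..<r} \<times> {..<r} \<times> {..<r}"
  have sub: "{(c, d). c < N \<and> d < N \<and> c \<noteq> d} \<subseteq> {..<N} \<times> {..<N}" by auto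
  then have fin: "finite {(c, d). c < N \<and> d < N \<and> c \<noteq> d}" by (rule finite_subset) auto
  have cN: "card {(c, d). c < N \<and> d < N \<and> c \<noteq> d} \<le> N\<^sup>2"
    using card_mono[OF _ sub] by (simp add: card_cartesian_product power2_eq_square)
  have "?L - simple_words \<subseteq> (\<Union>i\<in>?I. T i)"
  proof
    fix w assume "w \<in> ?L - simple_words"
    then obtain c d where w: "w \<in> ?L" and cd: "c < N" "d < N" "c \<noteq> d"
      and eq: "mset (block w d) = mset (block w c)"
      by (auto simp: simple_words_def inj_on_def)
    have "\<exists>j<r. w ! (d * r + i) = w ! (c * r + j)" if "i < r" for i
    proof -
      have "w ! (d * r + i) \<in> set (block w d)" using that by (auto simp: block_def)
      also have "set (block w d) = set (block w c)" using eq by (rule mset_eq_setD)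
      finally show ?thesis by (auto simp: block_def)
    qed
    from this[of 0] this[of 1] this[of 2] obtain j0 j1 j2
      where "j0 < r" "j1 < r" "j2 < r" "w ! (d * r) = w ! (c * r + j0)"
        "w ! (d * r + 1) = w ! (c * r + j1)" "w ! (d * r + 2) = w ! (c * r + j2)"
      using r3 by auto
    then have "w \<in> T ((c, d), j0, j1, j2)" "((c, d), j0, j1, j2) \<in> ?I" using w cd by (auto simp: T_def)
    then show "w \<in> (\<Union>i\<in>?I. T i)" by blast
  qed
  then have "card (?L - simple_words) \<le> card (\<Union>i\<in>?I. T i)"
    using fin by (intro card_mono) (auto simp: T_def)
  also have "\<dots> \<le> (\<Sum>i\<in>?I. card (T i))" using fin by (intro card_UN_le) auto
  finally have "card (?L - simple_words) * M ^ 3 \<le> (\<Sum>i\<in>?I. card (T i) * M ^ 3)"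
    by (simp add: sum_distrib_right[symmetric])
  also have "\<dots> \<le> (\<Sum>i\<in>?I. card ?L * (2 * K) ^ 3)"
  proof (intro sum_mono)
    fix i assume "i \<in> ?I"
    then obtain c d j0 j1 j2 where i: "i = ((c, d), j0, j1, j2)" and cd: "c < N" "d < N" "c \<noteq> d"
      and j: "j0 < r" "j1 < r" "j2 < r" by auto
    have r012: "0 < r" "1 < r" "2 < r" using r3 by auto
    have ne: "d * r + i \<noteq> c * r + j" if "i < r" "j < r" for i j
    proof -
      have "(d * r + i) div r = d" "(c * r + j) div r = c" using that by simp_all
      then show ?thesis using cd(3) by metis
    qed
    have "card {w \<in> ?L. w ! (d * r + 0) = w ! (c * r + j0)
      \<and> w ! (d * r + 1) = w ! (c * r + j1) \<and> w ! (d * r + 2) = w ! (c * r + j2)} * M ^ 3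
     \<le> card ?L * (2 * K) ^ 3"
    proof (rule card_triple_match[OF r3 M])
      show "{d * r + 0, d * r + 1, d * r + 2} \<inter> {c * r + j0, c * r + j1, c * r + j2} = {}"
        using ne j r012 by blast
    qed (intro position_less cd j r012 | simp)+
    then show "card (T i) * M ^ 3 \<le> card ?L * (2 * K) ^ 3" by (simp add: T_def i)
  qed
  also have "\<dots> = card ?I * (card ?L * (2 * K) ^ 3)" by simp
  also have "\<dots> \<le> (N\<^sup>2 * r ^ 3) * (card ?L * (2 * K) ^ 3)"
    using cN by (intro mult_right_mono) (auto simp: card_cartesian_product power3_eq_cube)
  finally show ?thesis .
qed

text \<open>
  Repeated edges change the count of loop-free words by a factor between
  \<open>1 - 8 * r * K ^ 3 / M\<close> and \<open>1\<close> (here \<open>N = M / r\<close> enters), so both sources of error are of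
  order \<open>r ^ 4 * K ^ 3 / M\<close> at most.
\<close>

lemma card_simple_words_estimate:
  assumes r3: "3 \<le> r" and M: "28 * r ^ 4 * K ^ 3 \<le> M"
  shows "\<exists>e. \<bar>e\<bar> \<le> 26 * (real r ^ 4 * real K ^ 3 / M) \<and>
    card simple_words = card words * exp (- ((real r - 1) * M2) / (2 * M) + e)"
proof -
  define \<rho> where "\<rho> = real r ^ 4 * real K ^ 3 / real M"
  let ?L = "avoiding block_pairs"
  define c where "c = - ((real r - 1) * M2 / (2 * M))"
  define \<delta> where "\<delta> = 10 * (real r)\<^sup>2 * (real K)\<^sup>2 / M"
  define \<eta> where "\<eta> = 8 * real r * real K ^ 3 / M"
  have r1: "1 \<le> real r" "1 \<le> real K" using r3 K_pos by auto
  have "r * K \<le> r ^ 4 * K ^ 3" using r_pos K_pos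
    by (intro mult_le_mono self_le_power) auto
  then have M': "28 * r * K \<le> M" "14 * r * K \<le> M" using M by simp_all
  have Mpos: "0 < M" using M' r_pos K_pos by (cases M) auto
  have m: "0 < real M" using Mpos by simp
  have "real r \<le> real r ^ 4" using r1 by (intro self_le_power) auto
  then have rK: "real r * real K ^ 3 \<le> real r ^ 4 * real K ^ 3"
    using r1 by (intro mult_right_mono) auto
  have \<delta>le: "\<delta> \<le> 10 * \<rho>"
  proof -
    have "(real r)\<^sup>2 * (real K)\<^sup>2 \<le> real r ^ 4 * real K ^ 3"
      using r1 by (intro mult_mono power_increasing) auto
    then show ?thesis using m by (simp add: \<delta>_def \<rho>_def divide_right_mono)
  qed
  have \<eta>le: "\<eta> \<le> 8 * \<rho>" using rK m by (simp add: \<eta>_def \<rho>_def divide_right_mono)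
  have "28 * real r ^ 4 * real K ^ 3 \<le> real M"
    using of_nat_mono[OF M, where 'a = real] by (simp only: of_nat_mult of_nat_power of_nat_numeral)
  then have "\<rho> \<le> 1 / 28" using m by (simp add: \<rho>_def field_simps)
  then have \<eta>half: "\<eta> \<le> 1 / 2" using \<eta>le by linarith
  have \<eta>0: "0 \<le> \<eta>" by (simp add: \<eta>_def)
  have sub: "simple_words \<subseteq> ?L" by (auto simp: simple_words_def)
  have up: "real (card simple_words) \<le> card ?L" using sub by (simp add: card_mono)
  have low: "(1 - \<eta>) * card ?L \<le> card simple_words"
  proof -
    have expand: "(n\<^sup>2 * s ^ 3) * (l * (2 * k) ^ 3) = 8 * s * k ^ 3 / m * l * m ^ 3"
      if "0 < m" "m = n * s" for n s l k m :: real
    proof -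
      have "8 * s * k ^ 3 / m * l * m ^ 3 = 8 * s * k ^ 3 * l * m\<^sup>2"
        using that(1) by (simp add: power2_eq_square power3_eq_cube)
      then show ?thesis unfolding that(2) by (simp add: power2_eq_square power3_eq_cube)
    qed
    have "real (card (?L - simple_words)) * real M ^ 3
       \<le> (real N ^ 2 * real r ^ 3) * (card ?L * (2 * real K) ^ 3)"
      using of_nat_mono[OF card_not_simple[OF r3 M'(2)], where 'a = real]
      by (simp only: of_nat_mult of_nat_power of_nat_numeral)
    also have "\<dots> = \<eta> * card ?L * real M ^ 3"
      unfolding \<eta>_def by (rule expand[OF m real_size_A])
    finally have "real (card (?L - simple_words)) \<le> \<eta> * card ?L" using m by simp
    moreover have "card (?L - simple_words) = card ?L - card simple_words"
      using sub finite_subset[OF sub] by (intro card_Diff_subset) auto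
    moreover have "card simple_words \<le> card ?L" using sub by (simp add: card_mono)
    ultimately show ?thesis by (simp add: algebra_simps of_nat_diff)
  qed
  have "\<bar>ln (1 + (- \<eta>)) - (- \<eta>)\<bar> \<le> 2 * (- \<eta>)\<^sup>2"
    using \<eta>half \<eta>0 by (intro abs_ln_one_plus_x_minus_x_bound) simp
  moreover have "\<eta> * \<eta> \<le> \<eta> * (1 / 2)" using \<eta>half \<eta>0 by (intro mult_left_mono) auto
  ultimately have "- 2 * \<eta> \<le> ln (1 - \<eta>)" by (simp add: power2_eq_square)
  then have exp\<eta>: "exp (- 2 * \<eta>) \<le> 1 - \<eta>" using \<eta>half by (simp add: ln_ge_iff)
  note bnd = card_loop_free_estimate[OF M'(1) Mpos, folded c_def \<delta>_def]
  have W: "0 < real (card words)" by (simp add: card_gt_0_iff)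
  have lower: "card words * exp (c - 26 * \<rho>) \<le> card simple_words"
  proof -
    have "card words * exp (c - 26 * \<rho>) \<le> card words * exp (- 2 * \<eta> + (c - \<delta>))"
      using \<delta>le \<eta>le by (intro mult_left_mono) auto
    also have "\<dots> = exp (- 2 * \<eta>) * (card words * exp (c - \<delta>))"
      by (simp only: exp_add ac_simps)
    also have "\<dots> \<le> (1 - \<eta>) * card ?L"
      using exp\<eta> bnd(1) \<eta>half by (intro mult_mono) auto
    finally show ?thesis using low by linarith
  qed
  have upper: "card simple_words \<le> card words * exp (c + 26 * \<rho>)"
  proof -
    have "\<rho> \<ge> 0" by (simp add: \<rho>_def)
    then have "card words * exp (c + \<delta>) \<le> card words * exp (c + 26 * \<rho>)"
      using \<delta>le by (intro mult_left_mono) auto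
    then show ?thesis using up bnd(2) by linarith
  qed
  have Spos: "0 < real (card simple_words)" using lower W
    by (meson exp_gt_zero less_le_trans mult_pos_pos)
  define e where "e = ln (card simple_words / card words) - c"
  have eq: "exp (c + e) = card simple_words / card words"
    using Spos W by (simp add: e_def)
  have "exp (c - 26 * \<rho>) \<le> exp (c + e)" "exp (c + e) \<le> exp (c + 26 * \<rho>)"
    unfolding eq using lower upper W by (simp_all add: field_simps)
  then have "\<bar>e\<bar> \<le> 26 * \<rho>" by simp
  moreover have "card simple_words = card words * exp (c + e)" using eq W by simp
  ultimately show ?thesis unfolding c_def \<rho>_def by (intro exI[of _ e]) simp
qed

end

section \<open>Words and hypergraphs\<close>

lemma concat_nth_uniform:
  assumes "\<And>l. l \<in> set ls \<Longrightarrow> length l = r" "c < length ls" "i < r"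
  shows "concat ls ! (c * r + i) = ls ! c ! i"
  using assms
proof (induction ls arbitrary: c)
  case (Cons l ls)
  then show ?case by (cases c) (auto simp: nth_append add.assoc)
qed simp

lemma length_concat_uniform:
  assumes "\<And>l. l \<in> set ls \<Longrightarrow> length l = r"
  shows "length (concat ls) = length ls * r"
  using assms by (induction ls) auto

lemma mset_concat_eq_Union: "mset (concat ls) = \<Sum>\<^sub># (image_mset mset (mset ls))"
  by (induction ls) auto

lemma distinct_iff_count_mset_le_1: "distinct l \<longleftrightarrow> (\<forall>v. count (mset l) v \<le> 1)"
proof
  assume r: "\<forall>v. count (mset l) v \<le> 1"
  show "distinct l" unfolding distinct_count_atmost_1
  proof
    fix a
    have "count (mset l) a \<noteq> 0 \<longleftrightarrow> a \<in> set l" by (metis count_eq_zero_iff set_mset_mset)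
    then show "count (mset l) a = (if a \<in> set l then 1 else 0)"
      using r[rule_format, of a] by (metis One_nat_def le_SucE le_zero_eq)
  qed
qed (simp add: distinct_count_atmost_1)

lemma card_permutations_of_multiset_distinct:
  assumes "\<And>v. count e v \<le> 1"
  shows "card (permutations_of_multiset e) = fact (size e)"
proof -
  have "count e v = 1" if "v \<in># e" for v
    using that assms[of v] by (simp add: le_Suc_eq count_eq_zero_iff)
  then show ?thesis using card_permutations_of_multiset_aux[of e] by simp
qed

lemma card_row_arrangements:
  assumes "\<And>e. e \<in> set es \<Longrightarrow> size e = r \<and> (\<forall>v. count e v \<le> 1)"
  shows "finite {ls. map mset ls = es} \<and> card {ls. map mset ls = es} = fact r ^ length es"
  using assms
proof (induction es)
  case (Cons e es)
  have eq: "{ls. map mset ls = e # es}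
      = (\<lambda>(l, ls). l # ls) ` (permutations_of_multiset e \<times> {ls. map mset ls = es})"
    by (auto simp: Cons_eq_map_conv permutations_of_multiset_def image_iff)
  have "card {ls. map mset ls = e # es} = card (permutations_of_multiset e) * card {ls. map mset ls = es}"
    unfolding eq by (subst card_image) (auto simp: inj_on_def card_cartesian_product)
  moreover have "card (permutations_of_multiset e) = fact r"
    using Cons.prems[of e] card_permutations_of_multiset_distinct[of e] by simp
  moreover have "finite {ls. map mset ls = e # es}"
    unfolding eq using Cons by (intro finite_imageI) simp
  ultimately show ?case using Cons by simp
qed simp

text \<open>
  Since the edges are distinct sets of size \<open>r\<close>, the edges can be ordered in \<open>fact (size E)\<close>
  ways and the vertices of each edge in \<open>fact r\<close> ways, without overcounting.
\<close>

lemma card_edge_arrangements: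
  assumes e: "\<And>e. e \<in># E \<Longrightarrow> size e = r \<and> (\<forall>v. count e v \<le> 1)"
    and E: "\<And>e. count E e \<le> 1"
  shows "finite {ls. mset (map mset ls) = E}"
    and "card {ls. mset (map mset ls) = E} = fact (size E) * fact r ^ size E"
proof -
  have eq: "{ls. mset (map mset ls) = E} = (\<Union>es\<in>permutations_of_multiset E. {ls. map mset ls = es})"
    by (auto simp: permutations_of_multiset_def)
  have row: "finite {ls. map mset ls = es} \<and> card {ls. map mset ls = es} = fact r ^ size E"
    if "es \<in> permutations_of_multiset E" for es
  proof -
    have m: "mset es = E" using that by (rule permutations_of_multisetD)
    then have "size e = r \<and> (\<forall>v. count e v \<le> 1)" if "e \<in> set es" for e
      using e that by (metis set_mset_mset)
    from card_row_arrangements[OF this] show ?thesis using m by auto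
  qed
  then show "finite {ls. mset (map mset ls) = E}" unfolding eq by simp
  have "card {ls. mset (map mset ls) = E} = (\<Sum>es\<in>permutations_of_multiset E. card {ls. map mset ls = es})"
    unfolding eq by (rule card_UN_disjoint) (use row in auto)
  also have "\<dots> = fact (size E) * fact r ^ size E"
    using row card_permutations_of_multiset_distinct[OF E] by simp
  finally show "card {ls. mset (map mset ls) = E} = fact (size E) * fact r ^ size E" .
qed

context block_words
begin

text \<open>
  These are the edge multisets of simple hypergraphs: for loop-free edges the degree of a
  vertex is its multiplicity in the union of the edges.
\<close>

definition edge_multisets :: "'a multiset multiset set" where
  "edge_multisets = {E. (\<forall>e. e \<in># E \<longrightarrow> size e = r \<and> (\<forall>v. count e v \<le> 1))
      \<and> (\<forall>e. count E e \<le> 1) \<and> \<Sum>\<^sub># E = A}"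

definition block_lists :: "'a list list set" where
  "block_lists = {ls. mset (map mset ls) \<in> edge_multisets}"

lemma size_edge_multiset:
  assumes "E \<in> edge_multisets"
  shows "size E = N"
proof -
  have "size (\<Sum>\<^sub># E) = r * size E" if "\<forall>e. e \<in># E \<longrightarrow> size e = r" for E :: "'a multiset multiset"
    using that by (induction E) auto
  then have "r * size E = size A" using assms by (auto simp: edge_multisets_def)
  then show ?thesis using size_A r_pos by simp
qed

lemma block_listsD:
  assumes "ls \<in> block_lists"
  shows "length ls = N" "l \<in> set ls \<Longrightarrow> length l = r" "l \<in> set ls \<Longrightarrow> distinct l"
    "distinct (map mset ls)" "mset (concat ls) = A"
proof -
  have E: "mset (map mset ls) \<in> edge_multisets" using assms by (simp add: block_lists_def)
  show "length ls = N" using size_edge_multiset[OF E] by simp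
  show "l \<in> set ls \<Longrightarrow> length l = r" "l \<in> set ls \<Longrightarrow> distinct l"
    using E by (auto simp: edge_multisets_def distinct_iff_count_mset_le_1)
  show "distinct (map mset ls)" using E by (simp add: edge_multisets_def distinct_iff_count_mset_le_1)
  show "mset (concat ls) = A"
    using E unfolding edge_multisets_def by (simp add: mset_concat_eq_Union)
qed

lemma block_listsI:
  assumes "\<And>l. l \<in> set ls \<Longrightarrow> length l = r \<and> distinct l"
    and "distinct (map mset ls)" "mset (concat ls) = A"
  shows "ls \<in> block_lists"
  using assms unfolding block_lists_def edge_multisets_def distinct_iff_count_mset_le_1
  by (auto simp: mset_concat_eq_Union)

lemma block_concat:
  assumes "ls \<in> block_lists" "c < N"
  shows "block (concat ls) c = ls ! c"
  using assms block_listsD[OF assms(1)]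
  by (intro nth_equalityI) (auto simp: block_def concat_nth_uniform)

lemma concat_blocks:
  assumes "w \<in> words"
  shows "concat (map (block w) [0..<N]) = w"
proof (rule nth_equalityI)
  have len: "length (concat (map (block w) [0..<N])) = N * r"
    by (subst length_concat_uniform[where r = r]) (auto simp: block_def)
  then show "length (concat (map (block w) [0..<N])) = length w"
    using length_word[OF assms] size_A by simp
  fix u assume "u < length (concat (map (block w) [0..<N]))"
  then have u: "u div r < N" "u mod r < r" using r_pos by (auto simp: len less_mult_imp_div_less)
  have "concat (map (block w) [0..<N]) ! ((u div r) * r + u mod r) = map (block w) [0..<N] ! (u div r) ! (u mod r)"
    by (rule concat_nth_uniform) (use u in \<open>auto simp: block_def\<close>)
  also have "\<dots> = w ! ((u div r) * r + u mod r)" using u by (simp add: block_def)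
  finally show "concat (map (block w) [0..<N]) ! u = w ! u" by simp
qed

lemma block_pairI: "x < M \<Longrightarrow> y < M \<Longrightarrow> x \<noteq> y \<Longrightarrow> x div r = y div r \<Longrightarrow> {x, y} \<in> block_pairs"
  unfolding block_pairs_def by (force simp: card_2_iff)

lemma bij_betw_concat_simple_words: "bij_betw concat block_lists simple_words"
  unfolding bij_betw_def
proof
  show "inj_on concat block_lists"
  proof (rule inj_onI)
    fix ls ls' assume ls: "ls \<in> block_lists" "ls' \<in> block_lists" and eq: "concat ls = concat ls'"
    have "ls ! c = ls' ! c" if "c < N" for c
      using block_concat[OF ls(1) that] block_concat[OF ls(2) that] eq by simp
    then show "ls = ls'" using block_listsD(1) ls by (intro nth_equalityI) auto
  qed
  show "concat ` block_lists = simple_words"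
  proof (intro equalityI subsetI)
    fix w assume "w \<in> concat ` block_lists"
    then obtain ls where ls: "ls \<in> block_lists" and w: "w = concat ls" by blast
    note D = block_listsD[OF ls]
    have "w ! x \<noteq> w ! y" if "{x, y} \<in> block_pairs" for x y
    proof -
      have xy: "x < M" "x \<noteq> y" "x div r = y div r" using block_pair_eqD[OF that] by auto
      have c: "x div r < N" using xy(1) size_A by (simp add: less_mult_imp_div_less)
      have nth: "w ! u = ls ! (u div r) ! (u mod r)" if "u div r < N" for u
        using concat_nth_uniform[of ls r "u div r" "u mod r"] D that r_pos w by simp
      have "x mod r \<noteq> y mod r" using xy(2,3) by (metis div_mult_mod_eq)
      moreover have "ls ! (x div r) \<in> set ls" using c D(1) by simp
      ultimately have "ls ! (x div r) ! (x mod r) \<noteq> ls ! (x div r) ! (y mod r)"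
        using D(2,3) r_pos by (simp add: nth_eq_iff_index_eq)
      then show ?thesis using nth[OF c] nth[of y] c xy(3) by simp
    qed
    moreover have "inj_on (\<lambda>c. mset (block w c)) {..<N}"
    proof (rule inj_onI)
      fix c d assume cd: "c \<in> {..<N}" "d \<in> {..<N}" "mset (block w c) = mset (block w d)"
      then have "map mset ls ! c = map mset ls ! d" using block_concat[OF ls] D(1) w by simp
      then show "c = d" using cd D(1,4) by (simp add: nth_eq_iff_index_eq del: nth_map)
    qed
    moreover have "w \<in> words" using D(5) w by (simp add: permutations_of_multiset_def)
    ultimately show "w \<in> simple_words" by (simp add: simple_words_def avoiding_def)
  next
    fix w assume "w \<in> simple_words"
    then have w: "w \<in> words" and av: "\<And>x y. {x, y} \<in> block_pairs \<Longrightarrow> w ! x \<noteq> w ! y"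
      and inj: "inj_on (\<lambda>c. mset (block w c)) {..<N}"
      by (auto simp: simple_words_def avoiding_def)
    have "distinct (block w c)" if c: "c < N" for c
    proof -
      have "inj_on (\<lambda>i. w ! (c * r + i)) {0..<r}"
      proof (rule inj_onI, rule ccontr)
        fix i j assume ij: "i \<in> {0..<r}" "j \<in> {0..<r}" "w ! (c * r + i) = w ! (c * r + j)" "i \<noteq> j"
        then have "{c * r + i, c * r + j} \<in> block_pairs"
          by (intro block_pairI position_less c) auto
        then show False using av ij(3) by blast
      qed
      then show ?thesis by (simp add: block_def distinct_map)
    qed
    moreover have "distinct (map mset (map (block w) [0..<N]))"
      using inj by (simp add: distinct_map inj_on_def)
    moreover have "mset (concat (map (block w) [0..<N])) = A"
      using concat_blocks[OF w] w by (simp add: permutations_of_multisetD)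
    ultimately have "map (block w) [0..<N] \<in> block_lists"
      by (intro block_listsI) (auto simp: block_def)
    then show "w \<in> concat ` block_lists" using concat_blocks[OF w] by (metis image_eqI)
  qed
qed

lemma card_simple_words:
  assumes "finite edge_multisets"
  shows "card simple_words = card edge_multisets * (fact N * fact r ^ N)"
proof -
  have arr: "finite {ls. mset (map mset ls) = E} \<and>
      card {ls. mset (map mset ls) = E} = fact N * fact r ^ N" if "E \<in> edge_multisets" for E
    using card_edge_arrangements[of E r] size_edge_multiset[OF that] that
    by (auto simp: edge_multisets_def)
  have "card simple_words = card block_lists"
    using bij_betw_same_card[OF bij_betw_concat_simple_words] by simp
  also have "block_lists = (\<Union>E\<in>edge_multisets. {ls. mset (map mset ls) = E})"
    by (auto simp: block_lists_def)
  also have "card \<dots> = (\<Sum>E\<in>edge_multisets. card {ls. mset (map mset ls) = E})"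
    by (rule card_UN_disjoint) (use assms arr in auto)
  also have "\<dots> = card edge_multisets * (fact N * fact r ^ N)" using arr by simp
  finally show ?thesis .
qed

end

section \<open>The asymptotic formula\<close>

definition degree_multiset :: "nat \<Rightarrow> (nat \<Rightarrow> nat) \<Rightarrow> nat multiset" where
  "degree_multiset n k = (\<Sum>j\<in>{1..n}. replicate_mset (k j) j)"

lemma count_degree_multiset: "count (degree_multiset n k) v = (if v \<in> {1..n} then k v else 0)"
  unfolding degree_multiset_def count_sum by (auto simp: if_distrib cong: if_cong)

lemma size_degree_multiset: "size (degree_multiset n k) = (\<Sum>j=1..n. k j)"
  unfolding degree_multiset_def by (simp add: size_multiset_sum)

lemma sum_degree_multiset:
  assumes "f 0 = (0 :: nat)"
  shows "(\<Sum>v\<in>set_mset (degree_multiset n k). f (count (degree_multiset n k) v)) = (\<Sum>j=1..n. f (k j))"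
proof -
  have "(\<Sum>v\<in>set_mset (degree_multiset n k). f (count (degree_multiset n k) v))
      = (\<Sum>v\<in>{1..n}. f (count (degree_multiset n k) v))"
    by (rule sum.mono_neutral_left)
      (auto simp: assms count_degree_multiset simp flip: count_greater_zero_iff split: if_splits)
  then show ?thesis by (simp add: count_degree_multiset)
qed

lemma prod_degree_multiset:
  "(\<Prod>v\<in>set_mset (degree_multiset n k). fact (count (degree_multiset n k) v)) = (\<Prod>j=1..n. fact (k j) :: nat)"
proof -
  have "(\<Prod>v\<in>set_mset (degree_multiset n k). fact (count (degree_multiset n k) v))
      = (\<Prod>v\<in>{1..n}. fact (count (degree_multiset n k) v) :: nat)"
    by (rule prod.mono_neutral_left)
      (auto simp: count_degree_multiset simp flip: count_greater_zero_iff split: if_splits)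
  then show ?thesis by (simp add: count_degree_multiset)
qed

lemma count_Union_mset_eq_degree:
  assumes "\<forall>e. e \<in># E \<longrightarrow> (\<forall>v. count e v \<le> 1)"
  shows "count (\<Sum>\<^sub># E) v = size (filter_mset (\<lambda>e. v \<in># e) E)"
  using assms
proof (induction E)
  case (add e E)
  have "count e v = (if v \<in># e then 1 else 0)"
    using add.prems by (auto simp: count_eq_zero_iff le_Suc_eq dest!: spec[of _ e] spec[of _ v])
  then show ?case using add by simp
qed simp

lemma simple_uniform_hypergraphs_eq_edge_multisets:
  assumes "block_words r N K (degree_multiset n k)"
  shows "simple_uniform_hypergraphs n r k = Pair {1..n} ` block_words.edge_multisets r (degree_multiset n k)"
proof -
  interpret block_words r N K "degree_multiset n k" by fact
  have "({1..n}, E) \<in> simple_uniform_hypergraphs n r k \<longleftrightarrow> E \<in> edge_multisets" for E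
  proof
    assume H: "({1..n}, E) \<in> simple_uniform_hypergraphs n r k"
    have sz: "\<forall>e. e \<in># E \<longrightarrow> size e = r" and sub: "\<forall>e. e \<in># E \<longrightarrow> set_mset e \<subseteq> {1..n}"
      and E1: "\<forall>e. e \<in># E \<longrightarrow> count E e = 1"
      and deg: "\<forall>j\<in>{1..n}. size (filter_mset (\<lambda>e. j \<in># e) E) = k j"
      using H by (auto simp: simple_uniform_hypergraphs_def simple_hypergraph_def
          uniform_hypergraph_def hypergraph_def vertex_degree_def)
    have "\<forall>e. e \<in># E \<longrightarrow> (\<forall>v. \<not> 2 \<le> count e v)"
      using H by (auto simp: simple_uniform_hypergraphs_def simple_hypergraph_def loop_in_def)
    then have e1: "\<forall>e. e \<in># E \<longrightarrow> (\<forall>v. count e v \<le> 1)"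
      by (metis One_nat_def Suc_1 not_less_eq_eq)
    have "\<Sum>\<^sub># E = degree_multiset n k"
    proof (rule multiset_eqI)
      fix v
      have "filter_mset (\<lambda>e. v \<in># e) E = {#}" if "v \<notin> {1..n}"
        using sub that unfolding filter_mset_eq_mempty_iff by blast
      then show "count (\<Sum>\<^sub># E) v = count (degree_multiset n k) v"
        using deg by (auto simp: count_Union_mset_eq_degree[OF e1] count_degree_multiset)
    qed
    moreover have "count E e \<le> 1" for e using E1 by (cases "e \<in># E") (auto simp: not_in_iff)
    ultimately show "E \<in> edge_multisets" using sz e1 by (simp add: edge_multisets_def)
  next
    assume E: "E \<in> edge_multisets"
    then have e: "\<forall>e. e \<in># E \<longrightarrow> size e = r" and e1: "\<forall>e. e \<in># E \<longrightarrow> (\<forall>v. count e v \<le> 1)"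
      and E1: "\<forall>e. count E e \<le> 1" and sum: "\<Sum>\<^sub># E = degree_multiset n k"
      by (auto simp: edge_multisets_def)
    have "set_mset e \<subseteq> {1..n}" if "e \<in># E" for e
    proof
      fix v assume "v \<in># e"
      then have "v \<in># degree_multiset n k" using that unfolding sum[symmetric] by blast
      then show "v \<in> {1..n}" by (auto simp: count_degree_multiset simp flip: count_greater_zero_iff split: if_splits)
    qed
    moreover have "count E e = 1" if "e \<in># E" for e
      using E1 that by (metis One_nat_def count_greater_eq_one_iff le_antisym)
    moreover have "\<not> 2 \<le> count e v" if "e \<in># E" for e v
      using e1 that by (metis One_nat_def Suc_1 not_less_eq_eq)
    moreover have "size (filter_mset (\<lambda>e. j \<in># e) E) = k j" if "j \<in> {1..n}" for j
      using that by (simp add: count_Union_mset_eq_degree[OF e1, symmetric] sum count_degree_multiset)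
    ultimately show "({1..n}, E) \<in> simple_uniform_hypergraphs n r k"
      using e by (auto simp: simple_uniform_hypergraphs_def simple_hypergraph_def
          uniform_hypergraph_def hypergraph_def vertex_degree_def loop_in_def)
  qed
  moreover have "fst H = {1..n}" if "H \<in> simple_uniform_hypergraphs n r k" for H
    using that by (simp add: simple_uniform_hypergraphs_def)
  ultimately show ?thesis by (force simp: image_iff)
qed

text \<open>
  The explicit form of the asymptotic formula, with absolute constants. All words together
  number \<open>M! / (\<Prod>j. (k j)!)\<close>, and every hypergraph accounts for \<open>N! * (r!) ^ N\<close> simple words.
\<close>

theorem card_simple_uniform_hypergraphs_estimate:
  fixes n r K :: nat and k :: "nat \<Rightarrow> nat"
  defines "M \<equiv> \<Sum>j=1..n. k j"
  assumes r: "3 \<le> r" and dvd: "r dvd M" and K: "0 < K" "\<And>j. j \<in> {1..n} \<Longrightarrow> k j \<le> K"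
    and M: "28 * r ^ 4 * K ^ 3 \<le> M"
  shows "\<exists>e. \<bar>e\<bar> \<le> 26 * (real r ^ 4 * real K ^ 3 / real M) \<and>
    real (card (simple_uniform_hypergraphs n r k)) =
      fact M / (fact (M div r) * fact r ^ (M div r) * (\<Prod>j=1..n. fact (k j)))
      * exp (- ((real r - 1) * real (\<Sum>j=1..n. k j * (k j - 1))) / (2 * real M) + e)"
proof -
  define A where "A = degree_multiset n k"
  define N where "N = M div r"
  have size_degrees: "size A = M" by (simp add: A_def M_def size_degree_multiset)
  have A: "block_words r N K A"
    by standard (use r K dvd size_degrees in \<open>auto simp: N_def A_def count_degree_multiset\<close>)
  interpret block_words r N K A by (rule A)
  have H: "simple_uniform_hypergraphs n r k = Pair {1..n} ` edge_multisets"
    using simple_uniform_hypergraphs_eq_edge_multisets A unfolding A_def by blast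
  have inj: "inj_on (Pair {1..n}) edge_multisets" by (auto simp: inj_on_def)
  have "finite edge_multisets"
    using finite_simple_uniform_hypergraphs[of n r k] finite_imageD[OF _ inj] unfolding H by blast
  then have S: "real (card simple_words) = real (card (simple_uniform_hypergraphs n r k)) * (fact N * fact r ^ N)"
    using card_simple_words card_image[OF inj] by (simp add: H)
  have m2: "M2 = (\<Sum>j=1..n. k j * (k j - 1))"
    unfolding M2_def unfolding A_def
    by (rule sum_degree_multiset[where f = "\<lambda>d. d * (d - 1)"]) simp
  have "card words * (\<Prod>j=1..n. fact (k j)) = fact M"
    using card_permutations_of_multiset_aux[of A] prod_degree_multiset[of n k] size_degrees
    unfolding A_def by simp
  then have "real (card words) * (\<Prod>j=1..n. fact (k j)) = fact M"
    by (metis (mono_tags, lifting) of_nat_fact of_nat_mult of_nat_prod prod.cong)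
  then have W: "real (card words) = fact M / (\<Prod>j=1..n. fact (k j))"
    by (simp add: field_simps)
  obtain e where e: "\<bar>e\<bar> \<le> 26 * (real r ^ 4 * real K ^ 3 / M)"
    "card simple_words = card words * exp (- ((real r - 1) * M2) / (2 * M) + e)"
    using card_simple_words_estimate[OF r] M unfolding size_degrees by auto
  show ?thesis
  proof (intro exI[of _ e] conjI)
    show "\<bar>e\<bar> \<le> 26 * (real r ^ 4 * real K ^ 3 / real M)" by (rule e)
    have "real (card (simple_uniform_hypergraphs n r k)) = card simple_words / (fact N * fact r ^ N)"
      unfolding S by simp
    also have "\<dots> = fact M / (fact N * fact r ^ N * (\<Prod>j=1..n. fact (k j)))
      * exp (- ((real r - 1) * real M2) / (2 * real M) + e)"
      unfolding e(2) W by simp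
    finally show "real (card (simple_uniform_hypergraphs n r k)) =
      fact M / (fact (M div r) * fact r ^ (M div r) * (\<Prod>j=1..n. fact (k j)))
      * exp (- ((real r - 1) * real (\<Sum>j=1..n. k j * (k j - 1))) / (2 * real M) + e)"
      unfolding N_def m2 .
  qed
qed

lemma eventually_along: "eventually P (along I) \<longleftrightarrow> eventually (\<lambda>n. n \<in> I \<longrightarrow> P n) sequentially"
  by (simp add: along_def eventually_inf_principal)

theorem corollary2p3:
  fixes r kmax M M2 :: "nat \<Rightarrow> nat"
    and k :: "nat \<Rightarrow> nat \<Rightarrow> nat"
    and I :: "nat set"
  assumes r_ge_3: "\<And>n. n \<ge> 3 \<Longrightarrow> r n \<ge> 3"
    and kmax: "\<And>n. n \<ge> 3 \<Longrightarrow> kmax n = Max (k n ` {1..n})"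
    and M: "\<And>n. n \<ge> 3 \<Longrightarrow> M n = (\<Sum>j=1..n. k n j)"
    and M2: "\<And>n. n \<ge> 3 \<Longrightarrow> M2 n = (\<Sum>j=1..n. k n j * (k n j - 1))"
    and I: "I = {n. n \<ge> 3 \<and> r n dvd M n}"
    and I_infinite: "infinite I"
    and M_to_infinity: "filterlim M at_top (along I)"
    and sparse: "(\<lambda>n. real (r n) ^ 4 * real (kmax n) ^ 3) \<in> o[along I](\<lambda>n. real (M n))"
  shows "\<exists>\<epsilon> :: nat \<Rightarrow> real.
    \<epsilon> \<in> O[along I](\<lambda>n. real (r n) ^ 4 * real (kmax n) ^ 3 / real (M n)) \<and>
    (\<forall>\<^sub>F n in along I.
       real (card (simple_uniform_hypergraphs n (r n) (k n))) =
         fact (M n)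
           / (fact (M n div r n) * fact (r n) ^ (M n div r n) * (\<Prod>i=1..n. fact (k n i)))
         * exp (- ((real (r n) - 1) * real (M2 n)) / (2 * real (M n)) + \<epsilon> n))"
proof -
  let ?err = "\<lambda>n. real (r n) ^ 4 * real (kmax n) ^ 3 / real (M n)"
  let ?eq = "\<lambda>n e. real (card (simple_uniform_hypergraphs n (r n) (k n))) =
         fact (M n)
           / (fact (M n div r n) * fact (r n) ^ (M n div r n) * (\<Prod>i=1..n. fact (k n i)))
         * exp (- ((real (r n) - 1) * real (M2 n)) / (2 * real (M n)) + e)"
  have step: "\<exists>e. \<bar>e\<bar> \<le> 26 * ?err n \<and> ?eq n e"
    if n: "n \<in> I" and pos: "1 \<le> M n" and small: "28 * r n ^ 4 * kmax n ^ 3 \<le> M n" for n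
  proof -
    have n3: "3 \<le> n" and dvd: "r n dvd M n" using n I by auto
    have le: "k n j \<le> kmax n" if "j \<in> {1..n}" for j
      unfolding kmax[OF n3] using that by (intro Max_ge) auto
    have "0 < kmax n"
    proof (rule ccontr)
      assume "\<not> 0 < kmax n"
      then have "k n j = 0" if "j \<in> {1..n}" for j using le[OF that] by simp
      then have "M n = 0" using M[OF n3] by simp
      then show False using pos by simp
    qed
    then show ?thesis
      using card_simple_uniform_hypergraphs_estimate[where n = n and r = "r n" and k = "k n" and K = "kmax n"] r_ge_3[OF n3] dvd le small
      unfolding M[OF n3] M2[OF n3] by blast
  qed
  define \<epsilon> where "\<epsilon> n = (SOME e. \<bar>e\<bar> \<le> 26 * ?err n \<and> ?eq n e)" for n
  have pos: "\<forall>\<^sub>F n in along I. 1 \<le> M n"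
    using M_to_infinity by (simp add: filterlim_at_top)
  have small: "\<forall>\<^sub>F n in along I. 28 * r n ^ 4 * kmax n ^ 3 \<le> M n"
  proof -
    have "\<forall>\<^sub>F n in along I. norm (real (r n) ^ 4 * real (kmax n) ^ 3) \<le> 1 / 28 * norm (real (M n))"
      by (rule landau_o.smallD[OF sparse]) simp
    then show ?thesis
    proof eventually_elim
      case (elim n)
      then have "28 * real (r n) ^ 4 * real (kmax n) ^ 3 \<le> real (M n)" by simp
      then show ?case
        by (simp only: of_nat_mult of_nat_power of_nat_numeral flip: of_nat_le_iff[where 'a = real])
    qed
  qed
  have "\<forall>\<^sub>F n in along I. n \<in> I" by (simp add: eventually_along)
  then have ev: "\<forall>\<^sub>F n in along I. \<bar>\<epsilon> n\<bar> \<le> 26 * ?err n \<and> ?eq n (\<epsilon> n)"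
    using pos small
  proof eventually_elim
    case (elim n)
    show ?case unfolding \<epsilon>_def by (rule someI_ex[OF step[OF elim]])
  qed
  show ?thesis
  proof (intro exI[of _ \<epsilon>] conjI)
    show "\<epsilon> \<in> O[along I](?err)"
      by (rule bigoI[where c = 26], rule eventually_mono[OF ev]) (auto simp: abs_mult)
    show "\<forall>\<^sub>F n in along I. ?eq n (\<epsilon> n)" using ev by (rule eventually_mono) simp
  qed
qed

end
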